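(* Let $\Lambda$ be a lattice with $\Lambda_R\subseteq\Lambda\subseteq\Lambda_W$, let $\Lambda_R\subseteq\Lambda_1,\Lambda_2\subseteq\Lambda$ be lattices such that $H_i=\Lambda_i/\Lambda_R$ satisfy $|H_1|=|H_2|=:d$ and $\operatorname{Cent}_{\Lambda_R}(\Lambda_1)=\operatorname{Cent}_{\Lambda_R}(\Lambda_2)=:\Lambda'$, let $g\colon H_1\times H_2\to\mathbb C^\times$ be a pairing of groups, and let $A_\ell\in\operatorname{End}_{\mathbb Z}(\Lambda_2)$ be a centralizer transfer map for $\Lambda_2$. Put $G_i=\Lambda_i/\Lambda'$ and let $$f(\mu,\nu)=\frac1{d\,|\Lambda_R/\Lambda'|}q^{-(\mu,\nu)}g(\bar\mu,\bar\nu)\delta_{\bar\mu\in H_1}\delta_{\bar\nu\in H_2}\quad\text{on }\Lambda/\Lambda'\times\Lambda/\Lambda'.$$ Then the following are equivalent: (i) $f$ satisfies the quasitriangularity conditions (E) of the context; (ii) the group pairing $\hat f(\lambda,\mu)=q^{-(\lambda,\mu)}g(\lambda,\mu)$ on $\Lambda_1/\Lambda'\times\Lambda_2/\Lambda'$ is non-degenerate; (iii) the form $a_g^\ell\colon\Lambda_1/\Lambda_R\times\Lambda_2/\Lambda_R\to\mathbb C^\times$, $a_g^\ell(\bar\lambda,\bar\mu)=q^{-(\lambda,A_\ell(\mu))}g(\lambda,A_\ell(\mu))$, is non-degenerate.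
   Context: Let $\mathfrak g$ be a finite-dimensional simple complex Lie algebra with simple roots $\alpha_1,\dots,\alpha_n$, and $(\cdot,\cdot)$ the invariant bilinear form normalized so that short roots satisfy $(\alpha,\alpha)=2$; $d_i=(\alpha_i,\alpha_i)/2$. $\Lambda_R$ is the root lattice, $\Lambda_W$ the weight lattice spanned by the $\lambda_i$ with $(\lambda_i,\alpha_j)=\delta_{ij}d_i$. Let $\ell\ge1$ be an integer, $q=\exp(2\pi i/\ell)$ and $q^r:=\exp(2\pi i r/\ell)$ for $r\in\mathbb Q$. For lattices $A,B$ put $\operatorname{Cent}_A(B)=\{\nu\in A\mid(\nu,\mu)\in\ell\mathbb Z\ \forall\mu\in B\}$. A bar denotes the class in $\Lambda/\Lambda_R$, and $g$ is also regarded as a function on $\Lambda_1\times\Lambda_2$. A centralizer transfer map for a lattice $\Lambda\supseteq\Lambda_R$ is a group endomorphism $A_\ell\in\operatorname{End}_{\mathbb Z}(\Lambda)$ with $A_\ell(\Lambda)=\operatorname{Cent}_\Lambda(\Lambda_R)$ and $A_\ell(\Lambda_R)=\operatorname{Cent}_{\Lambda_R}(\Lambda)$. Quasitriangularity conditions (E): for all $\alpha\in\Lambda_R$, $\mu,\mu_1,\mu_2\in G_1$, $\nu,\nu_1,\nu_2\in G_2$ (summation indices also running over $G_1$, resp. $G_2$): (1) $f(\mu+\alpha,\nu)=q^{-(\nu,\alpha)}f(\mu,\nu)$ and $f(\mu,\nu+\alpha)=q^{-(\mu,\alpha)}f(\mu,\nu)$; (2) $\sum_{\nu_1+\nu_2=\nu}f(\mu_1,\nu_1)f(\mu_2,\nu_2)=\delta_{\mu_1,\mu_2}f(\mu_1,\nu)$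 and $\sum_{\mu_1+\mu_2=\mu}f(\mu_1,\nu_1)f(\mu_2,\nu_2)=\delta_{\nu_1,\nu_2}f(\mu,\nu_1)$; (3) $\sum_{\mu}f(\mu,\nu)=\delta_{\nu,0}$ and $\sum_\nu f(\mu,\nu)=\delta_{\mu,0}$. (By a known theorem of Müller these characterize when $R_0\bar\Theta$, $R_0=\sum f(\mu,\nu)K_\mu\otimes K_\nu$, is an $R$-matrix for the small quantum group $u_q(\mathfrak g,\Lambda,\Lambda')$.) A pairing $A\times B\to\mathbb C^\times$ of finite abelian groups is non-degenerate if no non-zero $a\in A$ pairs trivially with all of $B$. *)

theory Defs
  imports Complex_Main "HOL-Library.Function_Algebras" "HOL-Algebra.Coset"
begin

locale lie_algebra = vector_space scale
  for scale :: "complex \<Rightarrow> 'g::ab_group_add \<Rightarrow> 'g" +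
  fixes bracket :: "'g \<Rightarrow> 'g \<Rightarrow> 'g"
  assumes bracket_add_left: "bracket (x + y) z = bracket x z + bracket y z"
    and bracket_add_right: "bracket x (y + z) = bracket x y + bracket x z"
    and bracket_scale_left: "bracket (scale c x) y = scale c (bracket x y)"
    and bracket_scale_right: "bracket x (scale c y) = scale c (bracket x y)"
    and bracket_self: "bracket x x = 0"
    and jacobi: "bracket x (bracket y z) + bracket y (bracket z x) + bracket z (bracket x y) = 0"

locale simple_lie_algebra = lie_algebra +
  assumes finite_dimensional: "\<exists>S. finite S \<and> span S = UNIV"
    and non_abelian: "\<exists>x y. bracket x y \<noteq> 0"
    and no_proper_ideal: "subspace I \<Longrightarrow> (\<And>x y. y \<in> I \<Longrightarrow> bracket x y \<in> I) \<Longrightarrow> I = {0} \<or> I = UNIV"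

text \<open>A Cartan subalgebra of a semisimple Lie algebra: a toral subalgebra (commutative, and consisting
  of ad-diagonalizable elements) that coincides with its centralizer.\<close>

definition cartan_subalgebra ::
  "(complex \<Rightarrow> 'g::ab_group_add \<Rightarrow> 'g) \<Rightarrow> ('g \<Rightarrow> 'g \<Rightarrow> 'g) \<Rightarrow> 'g set \<Rightarrow> bool" where
  "cartan_subalgebra scale bracket h \<longleftrightarrow>
     module.subspace scale h \<and>
     (\<forall>x\<in>h. \<forall>y\<in>h. bracket x y = 0) \<and>
     (\<forall>x\<in>h. module.span scale {y. \<exists>c. bracket x y = scale c y} = UNIV) \<and>
     (\<forall>x. (\<forall>y\<in>h. bracket x y = 0) \<longrightarrow> x \<in> h)"

text \<open>A linear functional on the subspace \<open>h\<close> is represented by its extension by zero off \<open>h\<close>, so that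
  equality, sums and integer multiples of functionals are those of functions.\<close>

definition dual_space ::
  "(complex \<Rightarrow> 'g::ab_group_add \<Rightarrow> 'g) \<Rightarrow> 'g set \<Rightarrow> ('g \<Rightarrow> complex) set" where
  "dual_space scale h =
     {\<phi>. (\<forall>x\<in>h. \<forall>y\<in>h. \<phi> (x + y) = \<phi> x + \<phi> y) \<and>
         (\<forall>c. \<forall>x\<in>h. \<phi> (scale c x) = c * \<phi> x) \<and>
         (\<forall>x. x \<notin> h \<longrightarrow> \<phi> x = 0)}"

definition root_space ::
  "(complex \<Rightarrow> 'g::ab_group_add \<Rightarrow> 'g) \<Rightarrow> ('g \<Rightarrow> 'g \<Rightarrow> 'g) \<Rightarrow> 'g set \<Rightarrow> ('g \<Rightarrow> complex) \<Rightarrow> 'g set" where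
  "root_space scale bracket h \<phi> = {x. \<forall>y\<in>h. bracket y x = scale (\<phi> y) x}"

definition roots ::
  "(complex \<Rightarrow> 'g::ab_group_add \<Rightarrow> 'g) \<Rightarrow> ('g \<Rightarrow> 'g \<Rightarrow> 'g) \<Rightarrow> 'g set \<Rightarrow> ('g \<Rightarrow> complex) set" where
  "roots scale bracket h =
     {\<phi> \<in> dual_space scale h. \<phi> \<noteq> 0 \<and> root_space scale bracket h \<phi> \<noteq> {0}}"

definition simple_roots ::
  "(complex \<Rightarrow> 'g::ab_group_add \<Rightarrow> 'g) \<Rightarrow> ('g \<Rightarrow> 'g \<Rightarrow> 'g) \<Rightarrow> 'g set \<Rightarrow>
   nat \<Rightarrow> (nat \<Rightarrow> 'g \<Rightarrow> complex) \<Rightarrow> bool" where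
  "simple_roots scale bracket h n \<alpha> \<longleftrightarrow>
     (\<forall>i\<in>{1..n}. \<alpha> i \<in> roots scale bracket h) \<and>
     (\<forall>c :: nat \<Rightarrow> complex. (\<forall>x. (\<Sum>i=1..n. c i * \<alpha> i x) = 0) \<longrightarrow> (\<forall>i\<in>{1..n}. c i = 0)) \<and>
     (\<forall>\<phi>\<in>dual_space scale h. \<exists>c :: nat \<Rightarrow> complex. \<phi> = (\<lambda>x. \<Sum>i=1..n. c i * \<alpha> i x)) \<and>
     (\<forall>\<beta>\<in>roots scale bracket h. \<exists>k :: nat \<Rightarrow> nat.
        \<beta> = (\<lambda>x. \<Sum>i=1..n. of_nat (k i) * \<alpha> i x) \<or> \<beta> = (\<lambda>x. - (\<Sum>i=1..n. of_nat (k i) * \<alpha> i x)))"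

definition invariant_form ::
  "(complex \<Rightarrow> 'g::ab_group_add \<Rightarrow> 'g) \<Rightarrow> ('g \<Rightarrow> 'g \<Rightarrow> 'g) \<Rightarrow> ('g \<Rightarrow> 'g \<Rightarrow> complex) \<Rightarrow> bool" where
  "invariant_form scale bracket B \<longleftrightarrow>
     (\<forall>x y z. B (x + y) z = B x z + B y z) \<and>
     (\<forall>c x y. B (scale c x) y = c * B x y) \<and>
     (\<forall>x y. B x y = B y x) \<and>
     (\<forall>x y z. B (bracket x y) z = B x (bracket y z)) \<and>
     (\<forall>x. (\<forall>y. B x y = 0) \<longrightarrow> x = 0)"

text \<open>The form on the dual of \<open>h\<close> obtained from the restriction of \<open>B\<close> to \<open>h\<close> (which is non-degenerate
  when \<open>B\<close> is a non-degenerate invariant form and \<open>h\<close> a Cartan subalgebra).\<close>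

definition riesz :: "'g set \<Rightarrow> ('g \<Rightarrow> 'g \<Rightarrow> complex) \<Rightarrow> ('g \<Rightarrow> complex) \<Rightarrow> 'g" where
  "riesz h B \<phi> = (THE t. t \<in> h \<and> (\<forall>x\<in>h. B t x = \<phi> x))"

definition dual_form ::
  "'g set \<Rightarrow> ('g \<Rightarrow> 'g \<Rightarrow> complex) \<Rightarrow> ('g \<Rightarrow> complex) \<Rightarrow> ('g \<Rightarrow> complex) \<Rightarrow> complex" where
  "dual_form h B \<phi> \<psi> = B (riesz h B \<phi>) (riesz h B \<psi>)"

text \<open>Short roots are the roots of minimal length; in the simply laced case all roots are short.\<close>

definition short_roots_normalized ::
  "(complex \<Rightarrow> 'g::ab_group_add \<Rightarrow> 'g) \<Rightarrow> ('g \<Rightarrow> 'g \<Rightarrow> 'g) \<Rightarrow> 'g set \<Rightarrow> ('g \<Rightarrow> 'g \<Rightarrow> complex) \<Rightarrow> bool" where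
  "short_roots_normalized scale bracket h B \<longleftrightarrow>
     (\<forall>\<beta>\<in>roots scale bracket h. dual_form h B \<beta> \<beta> \<in> \<real> \<and> Re (dual_form h B \<beta> \<beta>) \<ge> 2) \<and>
     (\<exists>\<beta>\<in>roots scale bracket h. dual_form h B \<beta> \<beta> = 2)"

definition fundamental_weights ::
  "(complex \<Rightarrow> 'g::ab_group_add \<Rightarrow> 'g) \<Rightarrow> 'g set \<Rightarrow> ('g \<Rightarrow> 'g \<Rightarrow> complex) \<Rightarrow> nat \<Rightarrow>
   (nat \<Rightarrow> 'g \<Rightarrow> complex) \<Rightarrow> (nat \<Rightarrow> 'g \<Rightarrow> complex) \<Rightarrow> bool" where
  "fundamental_weights scale h B n \<alpha> \<omega> \<longleftrightarrow>
     (\<forall>i\<in>{1..n}. \<omega> i \<in> dual_space scale h \<and>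
        (\<forall>j\<in>{1..n}. dual_form h B (\<omega> i) (\<alpha> j) =
           (if i = j then dual_form h B (\<alpha> i) (\<alpha> i) / 2 else 0)))"

definition int_span :: "nat \<Rightarrow> (nat \<Rightarrow> 'g \<Rightarrow> complex) \<Rightarrow> ('g \<Rightarrow> complex) set" where
  "int_span n v = {\<lambda>x. \<Sum>i=1..n. of_int (c i) * v i x |c. True}"

definition additive_group :: "'a::ab_group_add set \<Rightarrow> 'a monoid" where
  "additive_group L = \<lparr>carrier = L, monoid.mult = (+), one = 0\<rparr>"

definition coset :: "'a::ab_group_add set \<Rightarrow> 'a \<Rightarrow> 'a set" where
  "coset L x = L #>\<^bsub>additive_group UNIV\<^esub> x"

definition coset_rep :: "'a set \<Rightarrow> 'a" where
  "coset_rep X = (SOME x. x \<in> X)"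

definition Cent :: "('a \<Rightarrow> 'a \<Rightarrow> complex) \<Rightarrow> nat \<Rightarrow> 'a set \<Rightarrow> 'a set \<Rightarrow> 'a set" where
  "Cent form l A B = {\<nu> \<in> A. \<forall>\<mu>\<in>B. \<exists>k::int. form \<nu> \<mu> = of_nat l * of_int k}"

definition centralizer_transfer_map ::
  "('a::ab_group_add \<Rightarrow> 'a \<Rightarrow> complex) \<Rightarrow> nat \<Rightarrow> 'a set \<Rightarrow> 'a set \<Rightarrow> ('a \<Rightarrow> 'a) \<Rightarrow> bool" where
  "centralizer_transfer_map form l R L A \<longleftrightarrow>
     A \<in> hom (additive_group L) (additive_group L) \<and>
     A ` L = Cent form l L R \<and> A ` R = Cent form l R L"

text \<open>\<open>q_power l r\<close> is the power \<open>q\<^sup>r\<close> for \<open>q = exp (2 \<pi> i / l)\<close>; the form takes rational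
  values on the weight lattice.\<close>

definition q_power :: "nat \<Rightarrow> complex \<Rightarrow> complex" where
  "q_power l r = exp (2 * of_real pi * \<i> * r / of_nat l)"

definition pairing :: "'x monoid \<Rightarrow> 'y monoid \<Rightarrow> ('x \<Rightarrow> 'y \<Rightarrow> complex) \<Rightarrow> bool" where
  "pairing G H p \<longleftrightarrow>
     (\<forall>x\<in>carrier G. \<forall>y\<in>carrier H. p x y \<noteq> 0) \<and>
     (\<forall>x\<in>carrier G. \<forall>x'\<in>carrier G. \<forall>y\<in>carrier H. p (x \<otimes>\<^bsub>G\<^esub> x') y = p x y * p x' y) \<and>
     (\<forall>x\<in>carrier G. \<forall>y\<in>carrier H. \<forall>y'\<in>carrier H. p x (y \<otimes>\<^bsub>H\<^esub> y') = p x y * p x y')"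

definition nondegenerate_pairing :: "'x monoid \<Rightarrow> 'y monoid \<Rightarrow> ('x \<Rightarrow> 'y \<Rightarrow> complex) \<Rightarrow> bool" where
  "nondegenerate_pairing G H p \<longleftrightarrow>
     pairing G H p \<and> (\<forall>x\<in>carrier G. (\<forall>y\<in>carrier H. p x y = 1) \<longrightarrow> x = \<one>\<^bsub>G\<^esub>)"

text \<open>Below, \<open>R\<close> is the root lattice, \<open>L1\<close> and \<open>L2\<close> are the two lattices containing it, and \<open>L'\<close>
  is the sublattice of \<open>R\<close> centralizing them. Functions on quotients take cosets as arguments. In the
  first condition \<open>\<mu>\<close> and \<open>\<nu>\<close> run over representatives of the elements of the quotients.\<close>

definition quasitriangularity_conditions ::
  "('a::ab_group_add \<Rightarrow> 'a \<Rightarrow> complex) \<Rightarrow> nat \<Rightarrow> 'a set \<Rightarrow> 'a set \<Rightarrow> 'a set \<Rightarrow> 'a set \<Rightarrow>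
   ('a set \<Rightarrow> 'a set \<Rightarrow> complex) \<Rightarrow> bool" where
  "quasitriangularity_conditions form l R L1 L2 L' f \<longleftrightarrow>
     (let G1 = additive_group L1 Mod L'; G2 = additive_group L2 Mod L' in
       (\<forall>\<alpha>\<in>R. \<forall>\<mu>\<in>L1. \<forall>\<nu>\<in>L2.
          f (coset L' (\<mu> + \<alpha>)) (coset L' \<nu>) = q_power l (- form \<nu> \<alpha>) * f (coset L' \<mu>) (coset L' \<nu>) \<and>
          f (coset L' \<mu>) (coset L' (\<nu> + \<alpha>)) = q_power l (- form \<mu> \<alpha>) * f (coset L' \<mu>) (coset L' \<nu>)) \<and>
       (\<forall>X1\<in>carrier G1. \<forall>X2\<in>carrier G1. \<forall>Y\<in>carrier G2.
          (\<Sum>(Y1, Y2)\<in>{(Y1, Y2). Y1 \<in> carrier G2 \<and> Y2 \<in> carrier G2 \<and> Y1 \<otimes>\<^bsub>G2\<^esub> Y2 = Y}. f X1 Y1 * f X2 Y2)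
            = of_bool (X1 = X2) * f X1 Y) \<and>
       (\<forall>Y1\<in>carrier G2. \<forall>Y2\<in>carrier G2. \<forall>X\<in>carrier G1.
          (\<Sum>(X1, X2)\<in>{(X1, X2). X1 \<in> carrier G1 \<and> X2 \<in> carrier G1 \<and> X1 \<otimes>\<^bsub>G1\<^esub> X2 = X}. f X1 Y1 * f X2 Y2)
            = of_bool (Y1 = Y2) * f X Y1) \<and>
       (\<forall>Y\<in>carrier G2. (\<Sum>X\<in>carrier G1. f X Y) = of_bool (Y = \<one>\<^bsub>G2\<^esub>)) \<and>
       (\<forall>X\<in>carrier G1. (\<Sum>Y\<in>carrier G2. f X Y) = of_bool (X = \<one>\<^bsub>G1\<^esub>)))"

text \<open>The following three maps do not depend on the chosen coset representatives, since
  \<open>L'\<close> centralizes \<open>L1\<close> and \<open>L2\<close>, and \<open>A\<close> takes values in the centralizer of \<open>R\<close>.\<close>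

definition f_map ::
  "('a::ab_group_add \<Rightarrow> 'a \<Rightarrow> complex) \<Rightarrow> nat \<Rightarrow> 'a set \<Rightarrow> 'a set \<Rightarrow> 'a set \<Rightarrow> 'a set \<Rightarrow> nat \<Rightarrow>
   ('a set \<Rightarrow> 'a set \<Rightarrow> complex) \<Rightarrow> 'a set \<Rightarrow> 'a set \<Rightarrow> complex" where
  "f_map form l R L1 L2 L' d g X Y =
     (let \<mu> = coset_rep X; \<nu> = coset_rep Y in
        1 / (of_nat d * of_nat (order (additive_group R Mod L'))) *
        q_power l (- form \<mu> \<nu>) * g (coset R \<mu>) (coset R \<nu>) *
        of_bool (coset R \<mu> \<in> carrier (additive_group L1 Mod R)) *
        of_bool (coset R \<nu> \<in> carrier (additive_group L2 Mod R)))"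

definition f_hat ::
  "('a::ab_group_add \<Rightarrow> 'a \<Rightarrow> complex) \<Rightarrow> nat \<Rightarrow> 'a set \<Rightarrow>
   ('a set \<Rightarrow> 'a set \<Rightarrow> complex) \<Rightarrow> 'a set \<Rightarrow> 'a set \<Rightarrow> complex" where
  "f_hat form l R g X Y =
     (let \<mu> = coset_rep X; \<nu> = coset_rep Y in
        q_power l (- form \<mu> \<nu>) * g (coset R \<mu>) (coset R \<nu>))"

definition a_form ::
  "('a::ab_group_add \<Rightarrow> 'a \<Rightarrow> complex) \<Rightarrow> nat \<Rightarrow> 'a set \<Rightarrow>
   ('a set \<Rightarrow> 'a set \<Rightarrow> complex) \<Rightarrow> ('a \<Rightarrow> 'a) \<Rightarrow> 'a set \<Rightarrow> 'a set \<Rightarrow> complex" where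
  "a_form form l R g A X Y =
     (let \<mu> = coset_rep X; \<nu> = coset_rep Y in
        q_power l (- form \<mu> (A \<nu>)) * g (coset R \<mu>) (coset R (A \<nu>)))"

end

theory Submission
  imports Defs
begin

text \<open>
  All three conditions concern the bimultiplicative map \<open>\<chi> x y = q^(- (x, y)) * g x y\<close> on
  \<open>\<Lambda>\<^sub>1 \<times> \<Lambda>\<^sub>2\<close>. It is trivial on \<open>\<Lambda>'\<close> in either argument, and modulo \<open>\<Lambda>'\<close> it becomes the pairing
  in the second condition. Both quotients \<open>\<Lambda>\<^sub>i / \<Lambda>'\<close> have order \<open>N = d * |\<Lambda>\<^sub>R / \<Lambda>'|\<close>, so the map \<open>f\<close> is
  this pairing divided by \<open>N\<close>. Modulo \<open>\<Lambda>\<^sub>R\<close>, the form of the third condition is \<open>\<chi> x (A y)\<close>.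

  Quasitriangularity is equivalent to non-degeneracy by orthogonality of characters: the sum of a
  pairing over one argument is the order of the group times the indicator function of a kernel.
  Hence the counit-type sums and the convolutions of \<open>f\<close> have the required values exactly
  when both kernels of the pairing are trivial. Because the two groups have the same order, it is
  enough that the left kernel is trivial (\<open>quasitriangular_iff_nondegenerate\<close>). The rule for
  translations by roots holds for every \<open>g\<close>, since a root lattice element pairs through \<open>q\<close> alone.

  For the transfer to the quotients by \<open>\<Lambda>\<^sub>R\<close>, put \<open>C = Cent\<^bsub>\<Lambda>\<^sub>2\<^esub>(\<Lambda>\<^sub>R) = A(\<Lambda>\<^sub>2)\<close>; this is the annihilator
  of \<open>\<Lambda>\<^sub>R\<close> under \<open>\<chi>\<close>. Non-degeneracy of the third form says that every \<open>x\<close> annihilating \<open>C\<close> lies in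
  \<open>\<Lambda>\<^sub>R\<close>, which for a non-degenerate pairing modulo \<open>\<Lambda>'\<close> is the theorem on double annihilators.
  Conversely, if \<open>x\<close> annihilates \<open>\<Lambda>\<^sub>2\<close>, it annihilates \<open>C\<close>, hence lies in \<open>\<Lambda>\<^sub>R\<close>; there \<open>\<chi>\<close> is
  just a power of \<open>q\<close>, so \<open>x\<close> centralizes \<open>\<Lambda>\<^sub>2\<close> and lies in \<open>\<Lambda>'\<close>.

  The counting needs \<open>\<Lambda>\<^sub>i / \<Lambda>'\<close> to be finite, and this is where the Lie algebra enters. The root space
  decomposition shows that the invariant form is non-degenerate on the Cartan subalgebra, so that
  the form on weights is bilinear and non-degenerate. Representations of \<open>sl\<^sub>2\<close> make
  \<open>2 (\<beta>, \<alpha>) / (\<alpha>, \<alpha>)\<close> an integer for roots \<open>\<alpha>\<close> and \<open>\<beta>\<close>. Therefore a root \<open>\<beta>\<close> of rational length \<open>(\<beta>, \<beta>)\<close> is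
  orthogonal to every root of irrational length, and the former generate an ideal. As a
  short root has length \<open>2\<close>, simplicity forces all lengths to be rational
  (\<open>root_lengths_rational\<close>). Then the form is rational on the lattices involved, the fundamental
  weights are rational combinations of the simple roots, and some positive multiple of the weight
  lattice lies in \<open>\<Lambda>'\<close> (\<open>finite_cosets_Cent\<close>).
\<close>

section \<open>Pairings of finite abelian groups\<close>

lemma pairing_swap: "pairing G H p \<Longrightarrow> pairing H G (\<lambda>y x. p x y)"
  by (auto simp: pairing_def)

lemma pairing_subgroup:
  assumes "pairing G H p" "K \<subseteq> carrier G"
  shows "pairing (G\<lparr>carrier := K\<rparr>) H p"
  using assms by (auto simp: pairing_def subset_iff)

lemma pairing_one_left:
  assumes "group G" "pairing G H p" "y \<in> carrier H"
  shows "p \<one>\<^bsub>G\<^esub> y = 1"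
proof -
  interpret G: group G by fact
  have "p (\<one>\<^bsub>G\<^esub> \<otimes>\<^bsub>G\<^esub> \<one>\<^bsub>G\<^esub>) y = p \<one>\<^bsub>G\<^esub> y * p \<one>\<^bsub>G\<^esub> y"
    using assms(2,3) G.one_closed unfolding pairing_def by blast
  moreover have "p \<one>\<^bsub>G\<^esub> y \<noteq> 0"
    using assms(2,3) G.one_closed unfolding pairing_def by blast
  ultimately show ?thesis by simp
qed

lemma pairing_one_right:
  assumes "group H" "pairing G H p" "x \<in> carrier G"
  shows "p x \<one>\<^bsub>H\<^esub> = 1"
  using pairing_one_left[OF assms(1) pairing_swap[OF assms(2)] assms(3)] .

text \<open>If \<open>\<chi> y\<^sub>0 \<noteq> 1\<close>, translation by \<open>y\<^sub>0\<close> permutes the group and multiplies the sum by \<open>\<chi> y\<^sub>0\<close>, so the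
  sum vanishes.\<close>

lemma character_sum:
  fixes \<chi> :: "'x \<Rightarrow> complex"
  assumes "group K" and mult: "\<And>x y. x \<in> carrier K \<Longrightarrow> y \<in> carrier K \<Longrightarrow> \<chi> (x \<otimes>\<^bsub>K\<^esub> y) = \<chi> x * \<chi> y"
  shows "(\<Sum>y\<in>carrier K. \<chi> y) = of_nat (card (carrier K)) * of_bool (\<forall>y\<in>carrier K. \<chi> y = 1)"
proof (cases "\<forall>y\<in>carrier K. \<chi> y = 1")
  case False
  then obtain y0 where y0: "y0 \<in> carrier K" "\<chi> y0 \<noteq> 1" by blast
  interpret K: group K by fact
  have "(\<Sum>y\<in>carrier K. \<chi> y) = (\<Sum>y\<in>carrier K. \<chi> (y0 \<otimes>\<^bsub>K\<^esub> y))"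
    by (rule sum.reindex_bij_witness[of _ "\<lambda>y. y0 \<otimes>\<^bsub>K\<^esub> y" "\<lambda>y. inv\<^bsub>K\<^esub> y0 \<otimes>\<^bsub>K\<^esub> y"])
      (use y0 in \<open>simp_all flip: K.m_assoc\<close>)
  also have "\<dots> = \<chi> y0 * (\<Sum>y\<in>carrier K. \<chi> y)"
    using y0 by (simp add: mult sum_distrib_left)
  finally have "(\<Sum>y\<in>carrier K. \<chi> y) = 0"
    using y0(2) by (metis mult_cancel_right1)
  then show ?thesis
    using False by auto
qed simp

lemma pairing_sum_right:
  assumes "group H" "pairing G H p" "x \<in> carrier G"
  shows "(\<Sum>y\<in>carrier H. p x y) = of_nat (order H) * of_bool (\<forall>y\<in>carrier H. p x y = 1)"
  unfolding order_def using assms by (intro character_sum) (auto simp: pairing_def)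

lemma pairing_sum_left:
  assumes "group G" "pairing G H p" "y \<in> carrier H"
  shows "(\<Sum>x\<in>carrier G. p x y) = of_nat (order G) * of_bool (\<forall>x\<in>carrier G. p x y = 1)"
  unfolding order_def using assms by (intro character_sum) (auto simp: pairing_def)

text \<open>Both sides count the double sum of all values of the pairing, once by rows and once by columns.\<close>

lemma pairing_kernels_card:
  assumes "group G" "group H" "finite (carrier G)" "finite (carrier H)" "pairing G H p"
  shows "order H * card {x \<in> carrier G. \<forall>y\<in>carrier H. p x y = 1}
       = order G * card {y \<in> carrier H. \<forall>x\<in>carrier G. p x y = 1}"
proof -
  have "(\<Sum>x\<in>carrier G. \<Sum>y\<in>carrier H. p x y) = (\<Sum>y\<in>carrier H. \<Sum>x\<in>carrier G. p x y)"
    by (rule sum.swap)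
  then have "of_nat (order H * card {x \<in> carrier G. \<forall>y\<in>carrier H. p x y = 1})
      = (of_nat (order G * card {y \<in> carrier H. \<forall>x\<in>carrier G. p x y = 1}) :: complex)"
    using assms(3,4)
    by (simp add: pairing_sum_right[OF assms(2,5)] pairing_sum_left[OF assms(1,5)] of_bool_def
        flip: sum_distrib_left sum.inter_filter)
  then show ?thesis
    by (simp only: of_nat_eq_iff)
qed

lemma nondegenerate_pairing_kernel:
  assumes "group G" "nondegenerate_pairing G H p" "x \<in> carrier G"
  shows "(\<forall>y\<in>carrier H. p x y = 1) \<longleftrightarrow> x = \<one>\<^bsub>G\<^esub>"
  using assms pairing_one_left[of G H p] unfolding nondegenerate_pairing_def by blast

lemma nondegenerate_pairing_swap:
  assumes "group G" "group H" "finite (carrier G)" "finite (carrier H)" "order G = order H"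
    and "nondegenerate_pairing G H p"
  shows "nondegenerate_pairing H G (\<lambda>y x. p x y)"
proof -
  have p: "pairing G H p"
    using assms(6) by (simp add: nondegenerate_pairing_def)
  let ?K = "{y \<in> carrier H. \<forall>x\<in>carrier G. p x y = 1}"
  have "{x \<in> carrier G. \<forall>y\<in>carrier H. p x y = 1} = {\<one>\<^bsub>G\<^esub>}"
    using nondegenerate_pairing_kernel[OF assms(1,6)] monoid.one_closed[OF group.is_monoid[OF assms(1)]]
    by blast
  then have "card ?K = 1"
    using pairing_kernels_card[OF assms(1-4) p] assms(3,5)
      monoid.order_gt_0_iff_finite[OF group.is_monoid[OF assms(1)]] by simp
  then obtain k where k: "?K = {k}"
    by (rule card_1_singletonE)
  moreover have "\<one>\<^bsub>H\<^esub> \<in> ?K"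
    using pairing_one_right[OF assms(2) p] monoid.one_closed[OF group.is_monoid[OF assms(2)]] by blast
  ultimately have "\<one>\<^bsub>H\<^esub> \<in> {k}"
    by (simp only:)
  then have "k = \<one>\<^bsub>H\<^esub>"
    by simp
  then show ?thesis
    using pairing_swap[OF p] k unfolding nondegenerate_pairing_def by blast
qed

text \<open>The restriction of the pairing to \<open>K \<times> H\<close> has trivial left kernel, and its right kernel is the
  annihilator of \<open>K\<close>.\<close>

lemma annihilator_card:
  assumes "group G" "group H" "finite (carrier G)" "finite (carrier H)"
    and "nondegenerate_pairing G H p" "subgroup K G"
  shows "card K * card {y \<in> carrier H. \<forall>x\<in>K. p x y = 1} = order H"
proof -
  have KG: "K \<subseteq> carrier G" and K1: "\<one>\<^bsub>G\<^esub> \<in> K"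
    using assms(6) subgroup.subset subgroup.one_closed by blast+
  have p: "pairing G H p"
    using assms(5) by (simp add: nondegenerate_pairing_def)
  have "{x \<in> K. \<forall>y\<in>carrier H. p x y = 1} = {\<one>\<^bsub>G\<^esub>}"
    using K1 KG nondegenerate_pairing_kernel[OF assms(1,5)] by blast
  then show ?thesis
    using pairing_kernels_card[OF subgroup.subgroup_is_group[OF assms(6,1)] assms(2) _ assms(4)
        pairing_subgroup[OF p KG]] finite_subset[OF KG assms(3)]
    by (simp add: order_def)
qed

text \<open>Passing to the annihilator replaces the order of a subgroup by its index, so \<open>K\<close> and its double
  annihilator have the same order; one of them contains the other.\<close>

lemma double_annihilator:
  assumes G: "group G" "group H" "finite (carrier G)" "finite (carrier H)" "order G = order H"
    and p: "nondegenerate_pairing G H p" and K: "subgroup K G"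
    and x: "x \<in> carrier G" "\<And>y. y \<in> carrier H \<Longrightarrow> (\<forall>k\<in>K. p k y = 1) \<Longrightarrow> p x y = 1"
  shows "x \<in> K"
proof -
  interpret H: group H by fact
  define A where "A = {y \<in> carrier H. \<forall>k\<in>K. p k y = 1}"
  define A' where "A' = {x \<in> carrier G. \<forall>y\<in>A. p x y = 1}"
  have KG: "K \<subseteq> carrier G"
    using K by (rule subgroup.subset)
  have pair: "pairing G H p"
    using p by (simp add: nondegenerate_pairing_def)
  have p_inv: "p k (inv\<^bsub>H\<^esub> y) = 1" if "k \<in> carrier G" "y \<in> carrier H" "p k y = 1" for k y
  proof -
    have "p k (inv\<^bsub>H\<^esub> y \<otimes>\<^bsub>H\<^esub> y) = p k (inv\<^bsub>H\<^esub> y) * p k y"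
      using pair that H.inv_closed unfolding pairing_def by blast
    then show ?thesis
      using that pairing_one_right[OF G(2) pair] by simp
  qed
  have "subgroup A H"
  proof (rule H.subgroupI)
    show "A \<noteq> {}"
      using pairing_one_right[OF G(2) pair] KG by (auto simp: A_def)
    show "inv\<^bsub>H\<^esub> y \<in> A" if "y \<in> A" for y
      using that p_inv KG by (auto simp: A_def)
    show "y \<otimes>\<^bsub>H\<^esub> z \<in> A" if "y \<in> A" "z \<in> A" for y z
      using that KG pair by (auto simp: A_def pairing_def subset_iff)
  qed (auto simp: A_def)
  then have "card A * card A' = order G"
    using annihilator_card[OF G(2,1,4,3) nondegenerate_pairing_swap[OF G p]]
    by (simp add: A'_def)
  moreover have "card K * card A = order H"
    using annihilator_card[OF G(1-4) p K] by (simp add: A_def)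
  ultimately have "card K = card A'"
    using G(5) H.order_gt_0_iff_finite G(4) by (metis mult.commute mult_cancel1 mult_0 not_gr_zero)
  moreover have "K \<subseteq> A'"
    using KG by (auto simp: A'_def A_def)
  ultimately have "K = A'"
    using G(3) by (intro card_subset_eq) (auto simp: A'_def)
  moreover have "x \<in> A'"
    using x by (auto simp: A'_def A_def)
  ultimately show ?thesis by simp
qed

text \<open>Every summand is \<open>p x\<^sub>2 y * p (x\<^sub>1 x\<^sub>2\<^sup>-\<^sup>1) y\<^sub>1\<close> up to the factor \<open>N\<^sup>-\<^sup>2\<close>, so the sum is a character sum
  for \<open>x\<^sub>1 x\<^sub>2\<^sup>-\<^sup>1\<close>.\<close>

lemma pairing_convolution:
  assumes "comm_group H" "finite (carrier H)" "group G" "nondegenerate_pairing G H p"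
    and x: "x1 \<in> carrier G" "x2 \<in> carrier G" "y \<in> carrier H"
  shows "(\<Sum>(y1, y2)\<in>{(y1, y2). y1 \<in> carrier H \<and> y2 \<in> carrier H \<and> y1 \<otimes>\<^bsub>H\<^esub> y2 = y}.
      p x1 y1 / of_nat (order H) * (p x2 y2 / of_nat (order H)))
    = of_bool (x1 = x2) * (p x1 y / of_nat (order H))"
proof -
  interpret G: group G by fact
  interpret H: comm_group H by fact
  have pair: "pairing G H p"
    using assms(4) by (simp add: nondegenerate_pairing_def)
  let ?N = "of_nat (order H) :: complex"
  have N: "?N \<noteq> 0"
    using H.order_gt_0_iff_finite assms(2) by simp
  let ?z = "x1 \<otimes>\<^bsub>G\<^esub> inv\<^bsub>G\<^esub> x2"
  have quot: "p ?z y1 * p x2 y1 = p x1 y1" if "y1 \<in> carrier H" for y1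
  proof -
    have "p (?z \<otimes>\<^bsub>G\<^esub> x2) y1 = p ?z y1 * p x2 y1"
      using pair that x by (simp add: pairing_def)
    then show ?thesis
      using x by (simp add: G.m_assoc)
  qed
  have summand: "p x1 y1 * p x2 y2 = p x2 (y1 \<otimes>\<^bsub>H\<^esub> y2) * p ?z y1"
    if "y1 \<in> carrier H" "y2 \<in> carrier H" for y1 y2
  proof -
    have "p x2 (y1 \<otimes>\<^bsub>H\<^esub> y2) = p x2 y1 * p x2 y2"
      using pair that x by (simp add: pairing_def)
    then show ?thesis
      using quot[OF that(1)] by (simp add: mult_ac)
  qed
  have "(\<Sum>(y1, y2)\<in>{(y1, y2). y1 \<in> carrier H \<and> y2 \<in> carrier H \<and> y1 \<otimes>\<^bsub>H\<^esub> y2 = y}.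
      p x1 y1 / ?N * (p x2 y2 / ?N))
    = (\<Sum>y1\<in>carrier H. p x2 y / (?N * ?N) * p ?z y1)"
    by (rule sum.reindex_bij_witness[of _ "\<lambda>y1. (y1, inv\<^bsub>H\<^esub> y1 \<otimes>\<^bsub>H\<^esub> y)" fst])
      (use x(3) in \<open>auto simp: summand H.m_assoc[symmetric]\<close>)
  also have "\<dots> = p x2 y / (?N * ?N) * (?N * of_bool (\<forall>y1\<in>carrier H. p ?z y1 = 1))"
    unfolding sum_distrib_left[symmetric]
    by (subst pairing_sum_right[OF H.is_group pair]) (use x in simp_all)
  also have "(\<forall>y1\<in>carrier H. p ?z y1 = 1) \<longleftrightarrow> x1 = x2"
  proof
    assume "\<forall>y1\<in>carrier H. p ?z y1 = 1"
    then have "?z = \<one>\<^bsub>G\<^esub>"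
      using assms(4) x by (simp add: nondegenerate_pairing_def)
    then show "x1 = x2"
      using x G.inv_equality[of x1 "inv\<^bsub>G\<^esub> x2"] by simp
  qed (use x pairing_one_left[OF G.is_group pair] in simp)
  finally show ?thesis
    using N by auto
qed

text \<open>Already the last family of equations determines the left kernel, which gives one direction.
  The other one needs the right kernel too; that kernel is trivial because the two groups have equal
  order.\<close>

lemma quasitriangular_iff_nondegenerate:
  assumes "comm_group G" "comm_group H" and fin: "finite (carrier G)" "finite (carrier H)"
    and ord: "order G = N" "order H = N" and pair: "pairing G H p"
    and f: "\<And>x y. x \<in> carrier G \<Longrightarrow> y \<in> carrier H \<Longrightarrow> f x y = p x y / of_nat N"
  shows "((\<forall>X1\<in>carrier G. \<forall>X2\<in>carrier G. \<forall>Y\<in>carrier H.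
          (\<Sum>(Y1, Y2)\<in>{(Y1, Y2). Y1 \<in> carrier H \<and> Y2 \<in> carrier H \<and> Y1 \<otimes>\<^bsub>H\<^esub> Y2 = Y}. f X1 Y1 * f X2 Y2)
            = of_bool (X1 = X2) * f X1 Y) \<and>
       (\<forall>Y1\<in>carrier H. \<forall>Y2\<in>carrier H. \<forall>X\<in>carrier G.
          (\<Sum>(X1, X2)\<in>{(X1, X2). X1 \<in> carrier G \<and> X2 \<in> carrier G \<and> X1 \<otimes>\<^bsub>G\<^esub> X2 = X}. f X1 Y1 * f X2 Y2)
            = of_bool (Y1 = Y2) * f X Y1) \<and>
       (\<forall>Y\<in>carrier H. (\<Sum>X\<in>carrier G. f X Y) = of_bool (Y = \<one>\<^bsub>H\<^esub>)) \<and>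
       (\<forall>X\<in>carrier G. (\<Sum>Y\<in>carrier H. f X Y) = of_bool (X = \<one>\<^bsub>G\<^esub>)))
     \<longleftrightarrow> nondegenerate_pairing G H p" (is "?E1 \<and> ?E2 \<and> ?E3 \<and> ?E4 \<longleftrightarrow> ?N")
proof -
  interpret G: comm_group G by fact
  interpret H: comm_group H by fact
  have N: "N \<noteq> 0"
    using ord fin G.order_gt_0_iff_finite by auto
  have E4: "(\<Sum>Y\<in>carrier H. f X Y) = of_bool (\<forall>Y\<in>carrier H. p X Y = 1)" if "X \<in> carrier G" for X
  proof -
    have "(\<Sum>Y\<in>carrier H. f X Y) = (\<Sum>Y\<in>carrier H. p X Y) / of_nat N"
      using f that by (simp add: sum_divide_distrib)
    then show ?thesis
      using pairing_sum_right[OF H.is_group pair that] N ord by simp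
  qed
  have E3: "(\<Sum>X\<in>carrier G. f X Y) = of_bool (\<forall>X\<in>carrier G. p X Y = 1)" if "Y \<in> carrier H" for Y
  proof -
    have "(\<Sum>X\<in>carrier G. f X Y) = (\<Sum>X\<in>carrier G. p X Y) / of_nat N"
      using f that by (simp add: sum_divide_distrib)
    then show ?thesis
      using pairing_sum_left[OF G.is_group pair that] N ord by simp
  qed
  show ?thesis
  proof (intro iffI)
    assume "?E1 \<and> ?E2 \<and> ?E3 \<and> ?E4"
    then show ?N
      using pair E4 by (auto simp: nondegenerate_pairing_def)
  next
    assume nd: ?N
    have nd': "nondegenerate_pairing H G (\<lambda>y x. p x y)"
      using nondegenerate_pairing_swap[OF G.is_group H.is_group fin _ nd] ord by simp
    have ?E1
    proof (intro ballI)
      fix X1 X2 Y assume X: "X1 \<in> carrier G" "X2 \<in> carrier G" "Y \<in> carrier H"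
      have "(\<Sum>(Y1, Y2)\<in>{(Y1, Y2). Y1 \<in> carrier H \<and> Y2 \<in> carrier H \<and> Y1 \<otimes>\<^bsub>H\<^esub> Y2 = Y}. f X1 Y1 * f X2 Y2)
          = (\<Sum>(Y1, Y2)\<in>{(Y1, Y2). Y1 \<in> carrier H \<and> Y2 \<in> carrier H \<and> Y1 \<otimes>\<^bsub>H\<^esub> Y2 = Y}.
              p X1 Y1 / of_nat (order H) * (p X2 Y2 / of_nat (order H)))"
        by (rule sum.cong) (use f X ord in auto)
      then show "(\<Sum>(Y1, Y2)\<in>{(Y1, Y2). Y1 \<in> carrier H \<and> Y2 \<in> carrier H \<and> Y1 \<otimes>\<^bsub>H\<^esub> Y2 = Y}. f X1 Y1 * f X2 Y2)
          = of_bool (X1 = X2) * f X1 Y"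
        using pairing_convolution[OF \<open>comm_group H\<close> fin(2) G.is_group nd X] f X ord by simp
    qed
    moreover have ?E2
    proof (intro ballI)
      fix Y1 Y2 X assume X: "Y1 \<in> carrier H" "Y2 \<in> carrier H" "X \<in> carrier G"
      have "(\<Sum>(X1, X2)\<in>{(X1, X2). X1 \<in> carrier G \<and> X2 \<in> carrier G \<and> X1 \<otimes>\<^bsub>G\<^esub> X2 = X}. f X1 Y1 * f X2 Y2)
          = (\<Sum>(X1, X2)\<in>{(X1, X2). X1 \<in> carrier G \<and> X2 \<in> carrier G \<and> X1 \<otimes>\<^bsub>G\<^esub> X2 = X}.
              p X1 Y1 / of_nat (order G) * (p X2 Y2 / of_nat (order G)))"
        by (rule sum.cong) (use f X ord in auto)
      then show "(\<Sum>(X1, X2)\<in>{(X1, X2). X1 \<in> carrier G \<and> X2 \<in> carrier G \<and> X1 \<otimes>\<^bsub>G\<^esub> X2 = X}. f X1 Y1 * f X2 Y2)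
          = of_bool (Y1 = Y2) * f X Y1"
        using pairing_convolution[OF \<open>comm_group G\<close> fin(1) H.is_group nd' X] f X ord by simp
    qed
    moreover have ?E3
      using E3 nondegenerate_pairing_kernel[OF H.is_group nd'] by simp
    moreover have ?E4
      using E4 nondegenerate_pairing_kernel[OF G.is_group nd] by simp
    ultimately show "?E1 \<and> ?E2 \<and> ?E3 \<and> ?E4" by blast
  qed
qed

section \<open>Quotients of additive groups\<close>

text \<open>All lattices and quotients live in one ambient group; subgroups of a lattice in the sense of the
  library are those subgroups of the ambient group that it contains.\<close>

abbreviation is_lattice :: "'a::ab_group_add set \<Rightarrow> bool"
  where "is_lattice L \<equiv> subgroup L (additive_group UNIV)"

lemma additive_group_simps [simp]:
  "carrier (additive_group L) = L" "x \<otimes>\<^bsub>additive_group L\<^esub> y = x + y" "\<one>\<^bsub>additive_group L\<^esub> = 0"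
  by (simp_all add: additive_group_def)

lemma group_additive_UNIV: "group (additive_group (UNIV :: 'a::ab_group_add set))"
proof (rule groupI)
  show "\<exists>y\<in>carrier (additive_group UNIV). y \<otimes>\<^bsub>additive_group UNIV\<^esub> x = \<one>\<^bsub>additive_group UNIV\<^esub>" for x :: 'a
    by (auto intro: exI[of _ "- x"])
qed (simp_all add: add.assoc)

lemma inv_additive_UNIV [simp]: "inv\<^bsub>additive_group UNIV\<^esub> x = - x"
  by (rule group.inv_equality[OF group_additive_UNIV]) simp_all

lemma latticeD:
  assumes "is_lattice L"
  shows "0 \<in> L" "x \<in> L \<Longrightarrow> y \<in> L \<Longrightarrow> x + y \<in> L" "x \<in> L \<Longrightarrow> - x \<in> L" "x \<in> L \<Longrightarrow> y \<in> L \<Longrightarrow> x - y \<in> L"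
proof -
  show zero: "0 \<in> L" and add: "x \<in> L \<Longrightarrow> y \<in> L \<Longrightarrow> x + y \<in> L" and neg: "x \<in> L \<Longrightarrow> - x \<in> L" for x y
    using subgroup.one_closed[OF assms] subgroup.m_closed[OF assms] subgroup.m_inv_closed[OF assms]
    by simp_all
  show "x \<in> L \<Longrightarrow> y \<in> L \<Longrightarrow> x - y \<in> L"
    using add[of x "- y"] neg by simp
qed

lemma latticeI:
  assumes "0 \<in> L" "\<And>x y. x \<in> L \<Longrightarrow> y \<in> L \<Longrightarrow> x + y \<in> L" "\<And>x. x \<in> L \<Longrightarrow> - x \<in> L"
  shows "is_lattice L"
  using assms by unfold_locales auto

lemma additive_group_restrict: "additive_group L = (additive_group UNIV)\<lparr>carrier := L\<rparr>"
  by (simp add: additive_group_def)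

lemma sublattice_iff:
  assumes "is_lattice L"
  shows "subgroup M (additive_group L) \<longleftrightarrow> is_lattice M \<and> M \<subseteq> L"
proof
  assume M: "subgroup M (additive_group L)"
  then have "subgroup M ((additive_group UNIV)\<lparr>carrier := L\<rparr>)"
    by (simp flip: additive_group_restrict)
  then show "is_lattice M \<and> M \<subseteq> L"
    using group.incl_subgroup[OF group_additive_UNIV assms] subgroup.subset[OF M] by simp
next
  assume "is_lattice M \<and> M \<subseteq> L"
  then show "subgroup M (additive_group L)"
    unfolding additive_group_restrict[of L]
    using group.subgroup_incl[OF group_additive_UNIV _ assms] by blast
qed

lemma comm_group_additive:
  assumes "is_lattice L"
  shows "comm_group (additive_group L)"
proof -
  have "group (additive_group L)"
    unfolding additive_group_restrict[of L]
    using subgroup.subgroup_is_group[OF assms group_additive_UNIV] .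
  then show ?thesis
    by (rule group.group_comm_groupI) (simp add: add.commute)
qed

lemma coset_eq: "coset M x = (\<lambda>m. m + x) ` M"
  by (auto simp: coset_def r_coset_def)

lemma coset_eq_iff:
  assumes "is_lattice M"
  shows "coset M x = coset M y \<longleftrightarrow> x - y \<in> M"
proof
  assume "coset M x = coset M y"
  moreover have "x \<in> coset M x"
    using latticeD(1)[OF assms] by (force simp: coset_eq)
  ultimately show "x - y \<in> M"
    by (auto simp: coset_eq)
next
  assume xy: "x - y \<in> M"
  have "m + x \<in> coset M y" if "m \<in> M" for m
    using latticeD(2)[OF assms that xy] by (force simp: coset_eq algebra_simps)
  moreover have "m + y \<in> coset M x" if "m \<in> M" for m
    using latticeD(4)[OF assms that xy] by (force simp: coset_eq algebra_simps)
  ultimately show "coset M x = coset M y"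
    by (auto simp: coset_eq)
qed

lemma coset_rep_coset:
  assumes "is_lattice M"
  shows "coset_rep (coset M x) - x \<in> M"
proof -
  have "x \<in> coset M x"
    using latticeD(1)[OF assms] by (force simp: coset_eq)
  then have "coset_rep (coset M x) \<in> coset M x"
    unfolding coset_rep_def by (rule someI)
  then show ?thesis
    by (auto simp: coset_eq)
qed

lemma coset_coset_rep: "is_lattice M \<Longrightarrow> coset M (coset_rep (coset M x)) = coset M x"
  by (simp add: coset_eq_iff coset_rep_coset)

lemma coset_rep_in:
  assumes "is_lattice M" "is_lattice L" "M \<subseteq> L" "x \<in> L"
  shows "coset_rep (coset M x) \<in> L"
  using latticeD(2)[OF assms(2), of "coset_rep (coset M x) - x" x] coset_rep_coset[OF assms(1), of x] assms
  by auto

lemma coset_zero: "coset M 0 = M"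
  by (auto simp: coset_eq)

lemma carrier_quotient: "carrier (additive_group L Mod M) = coset M ` L"
  by (simp add: carrier_FactGroup coset_def r_coset_def)

lemma one_quotient: "\<one>\<^bsub>additive_group L Mod M\<^esub> = coset M 0"
  by (simp add: coset_zero)

lemma mult_quotient:
  assumes "is_lattice M"
  shows "coset M x \<otimes>\<^bsub>additive_group L Mod M\<^esub> coset M y = coset M (x + y)"
proof -
  have "m + x + (m' + y) \<in> coset M (x + y)" if "m \<in> M" "m' \<in> M" for m m'
    using latticeD(2)[OF assms that] by (force simp: coset_eq algebra_simps)
  moreover have "\<exists>k\<in>M. \<exists>k'\<in>M. m + (x + y) = k + x + (k' + y)" if "m \<in> M" for m
    using latticeD(1)[OF assms] that by (intro bexI[of _ m] bexI[of _ 0]) (simp_all add: algebra_simps)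
  ultimately show ?thesis
    by (auto simp: set_mult_def coset_eq[of M x] coset_eq[of M y]) (auto simp: coset_eq)
qed

lemma comm_group_quotient:
  assumes "is_lattice L" "is_lattice M" "M \<subseteq> L"
  shows "comm_group (additive_group L Mod M)"
  using comm_group.abelian_FactGroup[OF comm_group_additive] sublattice_iff assms by blast

text \<open>Maps defined through \<open>coset_rep\<close> can be computed with any other representatives, because two
  representatives differ by elements on which the pairing is trivial.\<close>

lemma pairing_quotient_eval:
  assumes M: "is_lattice M1" "is_lattice M2" "M1 \<subseteq> L1" "M2 \<subseteq> L2" and L: "is_lattice L1" "is_lattice L2"
    and P: "pairing (additive_group L1) (additive_group L2) P"
    and triv: "\<And>a y. a \<in> M1 \<Longrightarrow> y \<in> L2 \<Longrightarrow> P a y = 1" "\<And>x b. x \<in> L1 \<Longrightarrow> b \<in> M2 \<Longrightarrow> P x b = 1"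
    and xy: "x \<in> L1" "y \<in> L2"
  shows "P (coset_rep (coset M1 x)) (coset_rep (coset M2 y)) = P x y"
proof -
  define a where "a = coset_rep (coset M1 x) - x"
  define b where "b = coset_rep (coset M2 y) - y"
  have ab: "a \<in> M1" "b \<in> M2"
    using coset_rep_coset M by (auto simp: a_def b_def)
  have "P (a + x) (b + y) = P a (b + y) * P x (b + y)" "P x (b + y) = P x b * P x y"
    using P ab M(3,4) xy latticeD(2)[OF L(2)] by (auto simp: pairing_def subset_iff)
  moreover have "P a (b + y) = 1" "P x b = 1"
    using triv ab xy M(4) latticeD(2)[OF L(2)] by auto
  ultimately show ?thesis
    by (simp add: a_def b_def)
qed

lemma pairing_quotient:
  assumes M: "is_lattice M1" "is_lattice M2" "M1 \<subseteq> L1" "M2 \<subseteq> L2" and L: "is_lattice L1" "is_lattice L2"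
    and P: "pairing (additive_group L1) (additive_group L2) P"
    and p: "\<And>x y. x \<in> L1 \<Longrightarrow> y \<in> L2 \<Longrightarrow> p (coset M1 x) (coset M2 y) = P x y"
  shows "pairing (additive_group L1 Mod M1) (additive_group L2 Mod M2) p"
  using P M L unfolding pairing_def carrier_quotient
  by (auto simp: mult_quotient[simplified] p latticeD)

lemma nondegenerate_quotient_iff:
  assumes M: "is_lattice M1" "is_lattice M2" "M1 \<subseteq> L1" "M2 \<subseteq> L2" and L: "is_lattice L1" "is_lattice L2"
    and P: "pairing (additive_group L1) (additive_group L2) P"
    and p: "\<And>x y. x \<in> L1 \<Longrightarrow> y \<in> L2 \<Longrightarrow> p (coset M1 x) (coset M2 y) = P x y"
  shows "nondegenerate_pairing (additive_group L1 Mod M1) (additive_group L2 Mod M2) p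
    \<longleftrightarrow> (\<forall>x\<in>L1. (\<forall>y\<in>L2. P x y = 1) \<longrightarrow> x \<in> M1)"
  using pairing_quotient[OF assms] coset_eq_iff[OF M(1), of _ 0]
  unfolding nondegenerate_pairing_def carrier_quotient one_quotient
  by (simp add: p)

text \<open>The fibre of \<open>L/M \<rightarrow> L/R\<close> over the class of \<open>z\<close> is \<open>R/M\<close> translated by \<open>z\<close>.\<close>

lemma order_quotient_tower:
  assumes "is_lattice L" "is_lattice R" "is_lattice M" "R \<subseteq> L" "M \<subseteq> R" "finite (carrier (additive_group L Mod M))"
  shows "order (additive_group L Mod M) = order (additive_group L Mod R) * order (additive_group R Mod M)"
proof -
  define F where "F Z = {X \<in> coset M ` L. coset R (coset_rep X) = Z}" for Z
  have fin: "finite (coset M ` L)"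
    using assms(6) by (simp add: carrier_quotient)
  have proj: "coset R (coset_rep (coset M x)) = coset R x" for x
    using coset_rep_coset[OF assms(3), of x] assms(2,5) by (auto simp: coset_eq_iff)
  have "card (F (coset R z)) = card (coset M ` R)" if z: "z \<in> L" for z
  proof -
    have "bij_betw (\<lambda>X. coset M (coset_rep X + z)) (coset M ` R) (F (coset R z))"
    proof (rule bij_betwI')
      show "coset M (coset_rep X + z) = coset M (coset_rep Y + z) \<longleftrightarrow> X = Y"
        if XY: "X \<in> coset M ` R" "Y \<in> coset M ` R" for X Y
      proof -
        have "coset M (coset_rep X + z) = coset M (coset_rep Y + z) \<longleftrightarrow>
            coset M (coset_rep X) = coset M (coset_rep Y)"
          by (simp add: coset_eq_iff assms(3))
        then show ?thesis
          using XY coset_coset_rep[OF assms(3)] by auto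
      qed
      show "coset M (coset_rep X + z) \<in> F (coset R z)" if X: "X \<in> coset M ` R" for X
      proof -
        have "coset_rep X \<in> R"
          using X coset_rep_in[OF assms(3,2,5)] by auto
        then have "coset R (coset_rep X + z) = coset R z"
          by (simp add: coset_eq_iff assms(2))
        moreover have "coset_rep X + z \<in> L"
          using \<open>coset_rep X \<in> R\<close> z assms(4) latticeD(2)[OF assms(1)] by auto
        ultimately show ?thesis
          by (simp add: F_def proj)
      qed
      show "\<exists>X\<in>coset M ` R. Y = coset M (coset_rep X + z)" if Y: "Y \<in> F (coset R z)" for Y
      proof -
        obtain y where y: "y \<in> L" "Y = coset M y" "coset R y = coset R z"
          using Y by (auto simp: F_def proj)
        then have yz: "y - z \<in> R"
          by (simp add: coset_eq_iff assms(2))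
        have "coset_rep (coset M (y - z)) - (y - z) \<in> M"
          using assms(3) by (rule coset_rep_coset)
        then have "coset M (coset_rep (coset M (y - z)) + z) = Y"
          unfolding y(2) coset_eq_iff[OF assms(3)] by (simp add: algebra_simps)
        then show ?thesis using yz by blast
      qed
    qed
    then show ?thesis by (rule bij_betw_same_card[symmetric])
  qed
  then have fibre: "card (F Z) = card (coset M ` R)" if "Z \<in> coset R ` L" for Z
    using that by auto
  have "coset R ` L = (\<lambda>X. coset R (coset_rep X)) ` coset M ` L"
    by (auto simp: image_image proj)
  then have finR: "finite (coset R ` L)"
    using fin by simp
  have "card (coset M ` L) = card (\<Union>Z\<in>coset R ` L. F Z)"
    by (rule arg_cong[of _ _ card]) (auto simp: F_def proj)
  also have "\<dots> = (\<Sum>Z\<in>coset R ` L. card (F Z))"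
    using fin finR by (intro card_UN_disjoint) (auto simp: F_def)
  also have "\<dots> = card (coset R ` L) * card (coset M ` R)"
    using fibre by simp
  finally show ?thesis
    by (simp add: order_def carrier_quotient)
qed

section \<open>The pairing of the two quotients\<close>

lemma q_power_add: "q_power l (r + s) = q_power l r * q_power l s"
  by (simp add: q_power_def ring_distribs add_divide_distrib exp_add)

lemma q_power_minus_diff: "q_power l (- r - s) = q_power l (- r) * q_power l (- s)"
  using q_power_add[of l "- r" "- s"] by simp

lemma q_power_nonzero: "q_power l r \<noteq> 0"
  by (simp add: q_power_def)

lemma exp_eq_one_iff_complex: "exp z = 1 \<longleftrightarrow> (\<exists>k::int. z = 2 * of_real pi * \<i> * of_int k)"
proof
  assume e: "exp z = 1"
  then have "norm (exp z) = 1" by simp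
  then have re: "Re z = 0" by simp
  then have "cos (Im z) = 1"
    using e by (simp add: complex_eq_iff Re_exp)
  then obtain k :: int where "Im z = of_int k * 2 * pi"
    using cos_one_2pi_int by blast
  then have "z = 2 * of_real pi * \<i> * of_int k"
    using re by (simp add: complex_eq_iff)
  then show "\<exists>k::int. z = 2 * of_real pi * \<i> * of_int k" by blast
next
  assume "\<exists>k::int. z = 2 * of_real pi * \<i> * of_int k"
  then obtain k :: int where "z = \<i> * of_real (2 * pi * of_int k)"
    by (auto simp: mult_ac)
  then show "exp z = 1"
    by (simp add: exp_eq_polar complex_eq_iff cis.code flip: cis_conv_exp)
qed

lemma q_power_minus_eq_one_iff:
  assumes "l \<ge> 1"
  shows "q_power l (- r) = 1 \<longleftrightarrow> (\<exists>k::int. r = of_nat l * of_int k)"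
proof -
  have "2 * of_real pi * \<i> * (- r) / of_nat l = 2 * of_real pi * \<i> * of_int k
      \<longleftrightarrow> r = of_nat l * of_int (- k)" for k
  proof -
    have "2 * of_real pi * \<i> * (- r) / of_nat l = 2 * of_real pi * \<i> * of_int k
        \<longleftrightarrow> - r / of_nat l = of_int k"
      by (simp only: times_divide_eq_right[symmetric] mult_cancel_left) simp
    also have "\<dots> \<longleftrightarrow> - r = of_int k * of_nat l"
      by (rule nonzero_divide_eq_eq) (use assms in simp)
    also have "\<dots> \<longleftrightarrow> r = of_nat l * of_int (- k)"
      unfolding minus_equation_iff[of r] by (auto simp: mult.commute)
    finally show ?thesis .
  qed
  then have "q_power l (- r) = 1 \<longleftrightarrow> (\<exists>k::int. r = of_nat l * of_int (- k))"
    unfolding q_power_def exp_eq_one_iff_complex by simp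
  also have "\<dots> \<longleftrightarrow> (\<exists>k::int. r = of_nat l * of_int k)"
    by (metis minus_minus)
  finally show ?thesis .
qed

lemma lattice_Cent:
  assumes "is_lattice V" "is_lattice R" "R \<subseteq> V" "L \<subseteq> V"
    and add: "\<And>x y z. x \<in> V \<Longrightarrow> y \<in> V \<Longrightarrow> z \<in> V \<Longrightarrow> form (x + y) z = form x z + form y z"
  shows "is_lattice (Cent form l R L)"
proof (rule latticeI)
  have zero: "form 0 y = 0" if "y \<in> L" for y
    using add[of 0 0 y] that assms(4) latticeD(1)[OF assms(1)] by auto
  show "0 \<in> Cent form l R L"
    using zero latticeD(1)[OF assms(2)] by (auto simp: Cent_def intro: exI[of _ 0])
  show "x + y \<in> Cent form l R L" if xy: "x \<in> Cent form l R L" "y \<in> Cent form l R L" for x y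
  proof -
    have "\<exists>k::int. form (x + y) z = of_nat l * of_int k" if z: "z \<in> L" for z
    proof -
      obtain j k :: int where "form x z = of_nat l * of_int j" "form y z = of_nat l * of_int k"
        using xy z unfolding Cent_def by blast
      moreover have "form (x + y) z = form x z + form y z"
        using add[of x y z] xy z assms(3,4) by (auto simp: Cent_def)
      ultimately have "form (x + y) z = of_nat l * of_int (j + k)"
        by (simp add: ring_distribs)
      then show ?thesis by blast
    qed
    then show ?thesis
      using xy latticeD(2)[OF assms(2)] by (simp add: Cent_def)
  qed
  show "- x \<in> Cent form l R L" if x: "x \<in> Cent form l R L" for x
  proof -
    have "\<exists>k::int. form (- x) z = of_nat l * of_int k" if z: "z \<in> L" for z
    proof -
      obtain k :: int where k: "form x z = of_nat l * of_int k"
        using x z unfolding Cent_def by blast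
      have "form (- x + x) z = form (- x) z + form x z"
        using x z assms(3,4) latticeD(3)[OF assms(1)] by (intro add) (auto simp: Cent_def)
      then have "form (- x) z = of_nat l * of_int (- k)"
        using k zero[OF z] by (simp add: eq_neg_iff_add_eq_0)
      then show ?thesis by blast
    qed
    then show ?thesis
      using x latticeD(3)[OF assms(2)] by (simp add: Cent_def)
  qed
qed

text \<open>The lattice-theoretic content of the theorem: an arbitrary symmetric biadditive form replaces the
  form on weights, and finiteness of the quotients by \<open>L'\<close> is assumed.\<close>

locale transfer_setup =
  fixes form :: "'a::ab_group_add \<Rightarrow> 'a \<Rightarrow> complex" and l d :: nat and V R L1 L2 L' :: "'a set"
    and g :: "'a set \<Rightarrow> 'a set \<Rightarrow> complex" and A :: "'a \<Rightarrow> 'a"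
  assumes l: "l \<ge> 1"
    and lattices: "is_lattice V" "is_lattice R" "is_lattice L1" "is_lattice L2"
    and R: "R \<subseteq> L1" "R \<subseteq> L2" and V: "L1 \<subseteq> V" "L2 \<subseteq> V"
    and form_add_left: "\<And>x y z. x \<in> V \<Longrightarrow> y \<in> V \<Longrightarrow> z \<in> V \<Longrightarrow> form (x + y) z = form x z + form y z"
    and form_sym: "\<And>x y. x \<in> V \<Longrightarrow> y \<in> V \<Longrightarrow> form x y = form y x"
    and L': "Cent form l R L1 = L'" "Cent form l R L2 = L'"
    and finite_quotients: "finite (carrier (additive_group L1 Mod L'))"
      "finite (carrier (additive_group L2 Mod L'))"
    and orders: "order (additive_group L1 Mod R) = d" "order (additive_group L2 Mod R) = d"
    and g: "pairing (additive_group L1 Mod R) (additive_group L2 Mod R) g"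
    and A: "centralizer_transfer_map form l R L2 A"
begin

text \<open>This map descends to \<open>f_hat\<close>; composed with \<open>A\<close> in the second argument, it descends to \<open>a_form\<close>.\<close>

definition \<chi> :: "'a \<Rightarrow> 'a \<Rightarrow> complex"
  where "\<chi> x y = q_power l (- form x y) * g (coset R x) (coset R y)"

lemma form_add_right: "x \<in> V \<Longrightarrow> y \<in> V \<Longrightarrow> z \<in> V \<Longrightarrow> form z (x + y) = form z x + form z y"
  using form_add_left[of x y z] form_sym latticeD(2)[OF lattices(1)] by simp

lemma in_V: "x \<in> L1 \<Longrightarrow> x \<in> V" "x \<in> L2 \<Longrightarrow> x \<in> V" "x \<in> R \<Longrightarrow> x \<in> V"
  using R V by auto

lemma g_add_left:
  assumes "x \<in> L1" "x' \<in> L1" "y \<in> L2"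
  shows "g (coset R (x + x')) (coset R y) = g (coset R x) (coset R y) * g (coset R x') (coset R y)"
proof -
  have "g (coset R x \<otimes>\<^bsub>additive_group L1 Mod R\<^esub> coset R x') (coset R y)
      = g (coset R x) (coset R y) * g (coset R x') (coset R y)"
    using g assms unfolding pairing_def carrier_quotient by blast
  then show ?thesis
    by (simp only: mult_quotient[OF lattices(2)])
qed

lemma g_add_right:
  assumes "x \<in> L1" "y \<in> L2" "y' \<in> L2"
  shows "g (coset R x) (coset R (y + y')) = g (coset R x) (coset R y) * g (coset R x) (coset R y')"
proof -
  have "g (coset R x) (coset R y \<otimes>\<^bsub>additive_group L2 Mod R\<^esub> coset R y')
      = g (coset R x) (coset R y) * g (coset R x) (coset R y')"
    using g assms unfolding pairing_def carrier_quotient by blast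
  then show ?thesis
    by (simp only: mult_quotient[OF lattices(2)])
qed

lemma g_nonzero: "x \<in> L1 \<Longrightarrow> y \<in> L2 \<Longrightarrow> g (coset R x) (coset R y) \<noteq> 0"
  using g unfolding pairing_def carrier_quotient by blast

lemma coset_R: "a \<in> R \<Longrightarrow> coset R a = coset R 0"
  using coset_eq_iff[OF lattices(2), of a 0] by simp

lemma g_root_left: "a \<in> R \<Longrightarrow> y \<in> L2 \<Longrightarrow> g (coset R a) (coset R y) = 1"
  using g_add_left[of 0 0 y] g_nonzero[of 0 y] latticeD(1)[OF lattices(3)] by (simp add: coset_R)

lemma g_root_right: "x \<in> L1 \<Longrightarrow> b \<in> R \<Longrightarrow> g (coset R x) (coset R b) = 1"
  using g_add_right[of x 0 0] g_nonzero[of x 0] latticeD(1)[OF lattices(4)] by (simp add: coset_R)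

lemma \<chi>_root_left: "a \<in> R \<Longrightarrow> y \<in> L2 \<Longrightarrow> \<chi> a y = q_power l (- form a y)"
  by (simp add: \<chi>_def g_root_left)

lemma \<chi>_root_right: "x \<in> L1 \<Longrightarrow> b \<in> R \<Longrightarrow> \<chi> x b = q_power l (- form x b)"
  by (simp add: \<chi>_def g_root_right)

lemma \<chi>_pairing: "pairing (additive_group L1) (additive_group L2) \<chi>"
  unfolding pairing_def
proof (intro conjI ballI)
  fix x y assume "x \<in> carrier (additive_group L1)" "y \<in> carrier (additive_group L2)"
  then show "\<chi> x y \<noteq> 0"
    by (simp add: \<chi>_def q_power_nonzero g_nonzero)
next
  fix x x' y
  assume "x \<in> carrier (additive_group L1)" "x' \<in> carrier (additive_group L1)" "y \<in> carrier (additive_group L2)"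
  then show "\<chi> (x \<otimes>\<^bsub>additive_group L1\<^esub> x') y = \<chi> x y * \<chi> x' y"
    by (simp add: \<chi>_def form_add_left in_V g_add_left q_power_minus_diff)
next
  fix x y y'
  assume "x \<in> carrier (additive_group L1)" "y \<in> carrier (additive_group L2)" "y' \<in> carrier (additive_group L2)"
  then show "\<chi> x (y \<otimes>\<^bsub>additive_group L2\<^esub> y') = \<chi> x y * \<chi> x y'"
    by (simp add: \<chi>_def form_add_right in_V g_add_right q_power_minus_diff)
qed

lemma L'_iff1: "a \<in> L' \<longleftrightarrow> a \<in> R \<and> (\<forall>x\<in>L1. q_power l (- form x a) = 1)"
  unfolding L'(1)[symmetric] Cent_def q_power_minus_eq_one_iff[OF l]
  using form_sym in_V by fastforce

lemma L'_iff2: "a \<in> L' \<longleftrightarrow> a \<in> R \<and> (\<forall>y\<in>L2. q_power l (- form a y) = 1)"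
  unfolding L'(2)[symmetric] Cent_def q_power_minus_eq_one_iff[OF l] by blast

lemma \<chi>_trivial: "a \<in> L' \<Longrightarrow> y \<in> L2 \<Longrightarrow> \<chi> a y = 1" "x \<in> L1 \<Longrightarrow> a \<in> L' \<Longrightarrow> \<chi> x a = 1"
  using L'_iff1 L'_iff2 \<chi>_root_left \<chi>_root_right by auto

lemma L'_R: "L' \<subseteq> R"
  using L'_iff1 by blast

lemma L'_L: "L' \<subseteq> L1" "L' \<subseteq> L2"
  using L'_R R by auto

lemma lattice_L': "is_lattice L'"
  unfolding L'(2)[symmetric]
  by (rule lattice_Cent[OF lattices(1,2)]) (use form_add_left in_V in blast)+

lemma f_hat_coset:
  assumes "x \<in> L1" "y \<in> L2"
  shows "f_hat form l R g (coset L' x) (coset L' y) = \<chi> x y"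
  using pairing_quotient_eval[OF lattice_L' lattice_L' L'_L lattices(3,4) \<chi>_pairing \<chi>_trivial assms]
  by (simp add: f_hat_def \<chi>_def Let_def)

lemma f_hat_pairing:
  "pairing (additive_group L1 Mod L') (additive_group L2 Mod L') (f_hat form l R g)"
  using pairing_quotient[OF lattice_L' lattice_L' L'_L lattices(3,4) \<chi>_pairing f_hat_coset] .

lemma f_hat_nondegenerate_iff:
  "nondegenerate_pairing (additive_group L1 Mod L') (additive_group L2 Mod L') (f_hat form l R g)
    \<longleftrightarrow> (\<forall>x\<in>L1. (\<forall>y\<in>L2. \<chi> x y = 1) \<longrightarrow> x \<in> L')"
  using nondegenerate_quotient_iff[OF lattice_L' lattice_L' L'_L lattices(3,4) \<chi>_pairing f_hat_coset] .

abbreviation "N \<equiv> d * order (additive_group R Mod L')"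

lemma order_quotients: "order (additive_group L1 Mod L') = N" "order (additive_group L2 Mod L') = N"
  using order_quotient_tower[OF lattices(3,2) lattice_L' R(1) L'_R finite_quotients(1)]
    order_quotient_tower[OF lattices(4,2) lattice_L' R(2) L'_R finite_quotients(2)] orders by simp_all

lemma f_map_coset:
  assumes "x \<in> L1" "y \<in> L2"
  shows "f_map form l R L1 L2 L' d g (coset L' x) (coset L' y) = \<chi> x y / of_nat N"
proof -
  have "coset_rep (coset L' x) \<in> L1" "coset_rep (coset L' y) \<in> L2"
    using coset_rep_in lattice_L' L'_L lattices assms by auto
  then have "f_map form l R L1 L2 L' d g (coset L' x) (coset L' y)
      = f_hat form l R g (coset L' x) (coset L' y) / of_nat N"
    by (simp add: f_map_def f_hat_def Let_def carrier_quotient)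
  then show ?thesis
    using f_hat_coset assms by simp
qed

lemma f_map_shift:
  assumes a: "a \<in> R" and x: "x \<in> L1" and y: "y \<in> L2"
  shows "f_map form l R L1 L2 L' d g (coset L' (x + a)) (coset L' y)
      = q_power l (- form y a) * f_map form l R L1 L2 L' d g (coset L' x) (coset L' y)"
    "f_map form l R L1 L2 L' d g (coset L' x) (coset L' (y + a))
      = q_power l (- form x a) * f_map form l R L1 L2 L' d g (coset L' x) (coset L' y)"
proof -
  have "\<chi> (x + a) y = \<chi> x y * \<chi> a y" "\<chi> x (y + a) = \<chi> x y * \<chi> x a"
    using \<chi>_pairing a x y R by (auto simp: pairing_def)
  then have "\<chi> (x + a) y = q_power l (- form y a) * \<chi> x y" "\<chi> x (y + a) = q_power l (- form x a) * \<chi> x y"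
    using \<chi>_root_left \<chi>_root_right form_sym in_V a x y by simp_all
  then show "f_map form l R L1 L2 L' d g (coset L' (x + a)) (coset L' y)
      = q_power l (- form y a) * f_map form l R L1 L2 L' d g (coset L' x) (coset L' y)"
    "f_map form l R L1 L2 L' d g (coset L' x) (coset L' (y + a))
      = q_power l (- form x a) * f_map form l R L1 L2 L' d g (coset L' x) (coset L' y)"
    using a x y R latticeD(2)[OF lattices(3)] latticeD(2)[OF lattices(4)]
    by (simp_all add: f_map_coset subset_iff del: of_nat_mult)
qed

lemma quotient_groups:
  "comm_group (additive_group L1 Mod L')" "comm_group (additive_group L2 Mod L')"
  using comm_group_quotient lattices lattice_L' L'_L by auto

lemma quasitriangular_iff_f_hat_nondegenerate:
  "quasitriangularity_conditions form l R L1 L2 L' (f_map form l R L1 L2 L' d g)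
    \<longleftrightarrow> nondegenerate_pairing (additive_group L1 Mod L') (additive_group L2 Mod L') (f_hat form l R g)"
proof -
  have f: "f_map form l R L1 L2 L' d g X Y = f_hat form l R g X Y / of_nat N"
    if "X \<in> carrier (additive_group L1 Mod L')" "Y \<in> carrier (additive_group L2 Mod L')" for X Y
    using that f_map_coset f_hat_coset by (auto simp: carrier_quotient simp del: of_nat_mult)
  show ?thesis
    using quasitriangular_iff_nondegenerate[OF quotient_groups finite_quotients order_quotients f_hat_pairing f]
      f_map_shift
    unfolding quasitriangularity_conditions_def Let_def by blast
qed

lemma A_hom: "x \<in> L2 \<Longrightarrow> y \<in> L2 \<Longrightarrow> A (x + y) = A x + A y"
  and A_L2: "A ` L2 = Cent form l L2 R" and A_R: "A ` R = L'"
  using A unfolding L'(2)[symmetric] centralizer_transfer_map_def by (auto simp: hom_def)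

lemma A_in_L2: "y \<in> L2 \<Longrightarrow> A y \<in> L2"
  using A_L2 by (auto simp: Cent_def)

lemma Cent_L2_R: "c \<in> Cent form l L2 R \<longleftrightarrow> c \<in> L2 \<and> (\<forall>a\<in>R. \<chi> a c = 1)"
proof -
  have "(\<exists>k::int. form c a = of_nat l * of_int k) \<longleftrightarrow> \<chi> a c = 1" if "c \<in> L2" "a \<in> R" for a
    using that form_sym[of c a] in_V q_power_minus_eq_one_iff[OF l] \<chi>_root_left by simp
  then show ?thesis
    by (auto simp: Cent_def)
qed

lemma \<chi>_transfer_pairing: "pairing (additive_group L1) (additive_group L2) (\<lambda>x y. \<chi> x (A y))"
  using \<chi>_pairing A_hom A_in_L2 by (auto simp: pairing_def)

lemma \<chi>_transfer_trivial: "a \<in> R \<Longrightarrow> y \<in> L2 \<Longrightarrow> \<chi> a (A y) = 1" "x \<in> L1 \<Longrightarrow> b \<in> R \<Longrightarrow> \<chi> x (A b) = 1"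
  using A_L2 Cent_L2_R A_R \<chi>_trivial by blast+

lemma a_form_coset:
  assumes "x \<in> L1" "y \<in> L2"
  shows "a_form form l R g A (coset R x) (coset R y) = \<chi> x (A y)"
  using pairing_quotient_eval[OF lattices(2,2) R lattices(3,4) \<chi>_transfer_pairing \<chi>_transfer_trivial assms]
  by (simp add: a_form_def \<chi>_def Let_def)

lemma a_form_nondegenerate_iff:
  "nondegenerate_pairing (additive_group L1 Mod R) (additive_group L2 Mod R) (a_form form l R g A)
    \<longleftrightarrow> (\<forall>x\<in>L1. (\<forall>c\<in>Cent form l L2 R. \<chi> x c = 1) \<longrightarrow> x \<in> R)"
  using nondegenerate_quotient_iff[OF lattices(2,2) R lattices(3,4) \<chi>_transfer_pairing a_form_coset]
  unfolding A_L2[symmetric] by simp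

text \<open>The subgroup \<open>R/L'\<close> equals its double annihilator, and its annihilator is the image of the
  centralizer of \<open>R\<close>.\<close>

lemma annihilator_Cent:
  assumes nd: "nondegenerate_pairing (additive_group L1 Mod L') (additive_group L2 Mod L') (f_hat form l R g)"
    and x: "x \<in> L1" "\<forall>c\<in>Cent form l L2 R. \<chi> x c = 1"
  shows "x \<in> R"
proof -
  interpret G: comm_group "additive_group L1 Mod L'" by (rule quotient_groups)
  interpret H: comm_group "additive_group L2 Mod L'" by (rule quotient_groups)
  have K: "subgroup (coset L' ` R) (additive_group L1 Mod L')"
  proof (rule G.subgroupI)
    show "coset L' ` R \<subseteq> carrier (additive_group L1 Mod L')"
      using R(1) by (auto simp: carrier_quotient)
    show "coset L' ` R \<noteq> {}"
      using latticeD(1)[OF lattices(2)] by blast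
    show "X \<otimes>\<^bsub>additive_group L1 Mod L'\<^esub> Y \<in> coset L' ` R" if "X \<in> coset L' ` R" "Y \<in> coset L' ` R" for X Y
      using that mult_quotient[OF lattice_L'] latticeD(2)[OF lattices(2)] by (auto simp del: mult_FactGroup)
    show "inv\<^bsub>additive_group L1 Mod L'\<^esub> X \<in> coset L' ` R" if X: "X \<in> coset L' ` R" for X
    proof -
      obtain a where a: "a \<in> R" "X = coset L' a"
        using X by blast
      have "inv\<^bsub>additive_group L1 Mod L'\<^esub> X = coset L' (- a)"
        unfolding a(2)
      proof (rule G.inv_equality)
        show "coset L' (- a) \<otimes>\<^bsub>additive_group L1 Mod L'\<^esub> coset L' a = \<one>\<^bsub>additive_group L1 Mod L'\<^esub>"
          unfolding mult_quotient[OF lattice_L'] one_quotient by simp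
      qed (use a R latticeD(3)[OF lattices(3)] in \<open>auto simp: carrier_quotient\<close>)
      then show ?thesis
        using a latticeD(3)[OF lattices(2)] by blast
    qed
  qed
  have "coset L' x \<in> coset L' ` R"
  proof (rule double_annihilator[OF G.is_group H.is_group finite_quotients _ nd K])
    show "order (additive_group L1 Mod L') = order (additive_group L2 Mod L')"
      by (simp only: order_quotients)
    show "coset L' x \<in> carrier (additive_group L1 Mod L')"
      using x(1) by (simp add: carrier_quotient)
    show "f_hat form l R g (coset L' x) Y = 1"
      if Y: "Y \<in> carrier (additive_group L2 Mod L')" "\<forall>k\<in>coset L' ` R. f_hat form l R g k Y = 1" for Y
    proof -
      obtain y where y: "y \<in> L2" "Y = coset L' y"
        using Y(1) by (auto simp: carrier_quotient)
      have "\<chi> a y = 1" if "a \<in> R" for a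
        using Y(2) that y R f_hat_coset[of a y] by auto
      then show ?thesis
        using x y Cent_L2_R f_hat_coset by simp
    qed
  qed
  then obtain a where "a \<in> R" "coset L' x = coset L' a"
    by blast
  then have "a \<in> R" "x - a \<in> R"
    using L'_R by (auto simp: coset_eq_iff[OF lattice_L'])
  then show ?thesis
    using latticeD(2)[OF lattices(2), of "x - a" a] by simp
qed

lemma f_hat_nondegenerate_iff_a_form_nondegenerate:
  "nondegenerate_pairing (additive_group L1 Mod L') (additive_group L2 Mod L') (f_hat form l R g)
    \<longleftrightarrow> nondegenerate_pairing (additive_group L1 Mod R) (additive_group L2 Mod R) (a_form form l R g A)"
proof
  assume "nondegenerate_pairing (additive_group L1 Mod L') (additive_group L2 Mod L') (f_hat form l R g)"
  then show "nondegenerate_pairing (additive_group L1 Mod R) (additive_group L2 Mod R) (a_form form l R g A)"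
    unfolding a_form_nondegenerate_iff using annihilator_Cent by blast
next
  assume a: "nondegenerate_pairing (additive_group L1 Mod R) (additive_group L2 Mod R) (a_form form l R g A)"
  have "x \<in> L'" if x: "x \<in> L1" "\<forall>y\<in>L2. \<chi> x y = 1" for x
  proof -
    have "x \<in> R"
      using a x Cent_L2_R unfolding a_form_nondegenerate_iff by blast
    then show ?thesis
      using x(2) \<chi>_root_left by (simp add: L'_iff2)
  qed
  then show "nondegenerate_pairing (additive_group L1 Mod L') (additive_group L2 Mod L') (f_hat form l R g)"
    unfolding f_hat_nondegenerate_iff by blast
qed

end

section \<open>Simultaneous eigenvectors in Lie algebras\<close>

text \<open>Applying \<open>T - ev j\<close> to the relation removes the summand \<open>j\<close> and rescales the others by non-zero
  factors.\<close>

lemma (in vector_space) eigenvectors_independent: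
  assumes add: "\<And>x y. T (x + y) = T x + T y" and scl: "\<And>c x. T (scale c x) = scale c (T x)"
    and "finite I" "inj_on ev I" "\<And>i. i \<in> I \<Longrightarrow> T (v i) = scale (ev i) (v i)"
    and "(\<Sum>i\<in>I. v i) = 0" "i \<in> I"
  shows "v i = 0"
  using assms(3-)
proof (induction I arbitrary: v i rule: finite_induct)
  case empty
  then show ?case by simp
next
  case (insert j I)
  have T0: "T 0 = 0"
    using add[of 0 0] by simp
  have Tsum: "T (\<Sum>i\<in>S. u i) = (\<Sum>i\<in>S. T (u i))" if "finite S" for S and u :: "'c \<Rightarrow> 'b"
    using that by (induction S rule: finite_induct) (simp_all add: T0 add)
  have "T (\<Sum>i\<in>insert j I. v i) - scale (ev j) (\<Sum>i\<in>insert j I. v i) = 0"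
    by (simp only: insert.prems(3) T0 scale_zero_right diff_self)
  moreover have "T (\<Sum>i\<in>insert j I. v i) = (\<Sum>i\<in>insert j I. scale (ev i) (v i))"
    using insert.hyps(1) insert.prems(2) by (subst Tsum) auto
  ultimately have "(\<Sum>i\<in>insert j I. scale (ev i - ev j) (v i)) = 0"
    by (simp only: scale_sum_right scale_left_diff_distrib sum_subtractf)
  then have zero: "(\<Sum>i\<in>I. scale (ev i - ev j) (v i)) = 0"
    using insert.hyps by simp
  have vI: "v i = 0" if "i \<in> I" for i
  proof -
    have "scale (ev i - ev j) (v i) = 0"
    proof (rule insert.IH[OF _ _ zero that])
      show "inj_on ev I"
        using insert.prems(1) by (simp add: inj_on_def)
      show "T (scale (ev k - ev j) (v k)) = scale (ev k) (scale (ev k - ev j) (v k))" if "k \<in> I" for k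
        using that insert.prems(2)[of k] by (simp add: scl mult.commute)
    qed
    moreover have "ev i \<noteq> ev j"
      using insert.prems(1) insert.hyps(2) that by (auto simp: inj_on_def)
    ultimately show ?thesis by simp
  qed
  have "v j = 0"
    using insert.prems(3) insert.hyps vI by simp
  then show ?case
    using vI insert.prems(4) by auto
qed

lemma (in vector_space) eigenvector_decomposition:
  assumes add: "\<And>x y. T (x + y) = T x + T y" and scl: "\<And>c x. T (scale c x) = scale c (T x)"
    and "x \<in> span {y. \<exists>c. T y = scale c y}"
  shows "\<exists>C v. finite C \<and> (\<forall>c\<in>C. T (v c) = scale c (v c)) \<and> x = (\<Sum>c\<in>C. v c)"
  using assms(3)
proof (induction rule: span_induct_alt)
  case base
  show ?case by (rule exI[of _ "{}"]) simp
next
  case (step k e y)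
  from step.hyps obtain c0 where c0: "T e = scale c0 e" by auto
  from step.IH obtain C v where C: "finite C" "\<forall>c\<in>C. T (v c) = scale c (v c)" "y = (\<Sum>c\<in>C. v c)"
    by auto
  define w where "w = v(c0 := (if c0 \<in> C then v c0 else 0) + scale k e)"
  have "T 0 = 0"
    using add[of 0 0] by simp
  then have "\<forall>c\<in>insert c0 C. T (w c) = scale c (w c)"
    using C(2) c0 by (auto simp: w_def add scl scale_right_distrib mult.commute)
  moreover have "scale k e + y = (\<Sum>c\<in>insert c0 C. w c)"
  proof -
    have rest: "(\<Sum>c\<in>C - {c0}. w c) = (\<Sum>c\<in>C - {c0}. v c)"
      by (rule sum.cong) (auto simp: w_def)
    show ?thesis
    proof (cases "c0 \<in> C")
      case True
      then show ?thesis
        using C(1,3) rest by (simp add: insert_absorb sum.remove[of C c0] w_def algebra_simps)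
    next
      case False
      then show ?thesis
        using C(1,3) rest by (simp add: w_def)
    qed
  qed
  ultimately show ?case
    using C(1) by (intro exI[of _ "insert c0 C"] exI[of _ w]) simp
qed

text \<open>This is how finite dimension terminates the ladders of root vectors.\<close>

lemma (in vector_space) eigenvector_sequence_vanishes:
  assumes add: "\<And>x y. T (x + y) = T x + T y" and scl: "\<And>c x. T (scale c x) = scale c (T x)"
    and fin: "finite S" "span S = UNIV"
    and ev: "inj ev" "\<And>k::nat. T (v k) = scale (ev k) (v k)"
  shows "\<exists>k. v k = 0"
proof (rule ccontr)
  assume "\<nexists>k. v k = 0"
  then have nz: "v k \<noteq> 0" for k by simp
  have "inj v"
  proof (rule injI)
    fix j k
    assume "v j = v k"
    then have "scale (ev j) (v j) = scale (ev k) (v j)"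
      using ev(2)[of j] ev(2)[of k] by metis
    then have "ev j = ev k"
      using nz[of j] by simp
    then show "j = k"
      using ev(1) by (simp add: inj_eq)
  qed
  have "independent (range v)"
    unfolding dependent_explicit
  proof (intro notI, elim exE conjE)
    fix t u
    assume t: "finite t" "t \<subseteq> range v" "(\<Sum>w\<in>t. scale (u w) w) = 0" "\<exists>w\<in>t. u w \<noteq> 0"
    then obtain w where w: "w \<in> t" "u w \<noteq> 0" by auto
    have "scale (u w) w = 0"
    proof (rule eigenvectors_independent[where T = T and I = t and i = w
          and v = "\<lambda>w. scale (u w) w" and ev = "\<lambda>w. ev (inv_into UNIV v w)"])
      show "inj_on (\<lambda>w. ev (inv_into UNIV v w)) t"
      proof (rule inj_onI)
        fix x y
        assume xy: "x \<in> t" "y \<in> t" "ev (inv_into UNIV v x) = ev (inv_into UNIV v y)"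
        then have "inv_into UNIV v x = inv_into UNIV v y"
          using ev(1) by (simp add: inj_eq)
        moreover have "x \<in> range v" "y \<in> range v"
          using xy t(2) by auto
        ultimately show "x = y"
          by (metis f_inv_into_f)
      qed
      show "T (scale (u x) x) = scale (ev (inv_into UNIV v x)) (scale (u x) x)" if "x \<in> t" for x
      proof -
        from that t(2) obtain k where "x = v k" by auto
        then show ?thesis
          using \<open>inj v\<close> ev(2)[of k] by (simp add: scl mult.commute)
      qed
    qed (use add scl t w in auto)
    then show False
      using w t(2) nz by auto
  qed
  then have "finite (range v)"
    using independent_span_bound[OF fin(1)] fin(2) by simp
  then show False
    using \<open>inj v\<close> finite_imageD by blast
qed

lemma (in lie_algebra) bracket_zero_left [simp]: "bracket 0 y = 0"
  using bracket_add_left[of 0 0 y] by simp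

lemma (in lie_algebra) bracket_zero_right [simp]: "bracket y 0 = 0"
  using bracket_add_right[of y 0 0] by simp

lemma (in lie_algebra) bracket_antisym: "bracket x y = - bracket y x"
proof -
  have "bracket (x + y) (x + y) = bracket x y + bracket y x"
    by (simp add: bracket_add_left bracket_add_right bracket_self[of x] bracket_self[of y])
  then show ?thesis
    by (metis bracket_self eq_neg_iff_add_eq_0)
qed

text \<open>The Jacobi identity as a Leibniz rule: \<open>ad x\<close> is a derivation.\<close>

lemma (in lie_algebra) bracket_bracket:
  "bracket x (bracket y z) = bracket (bracket x y) z + bracket y (bracket x z)"
proof -
  have "bracket y (bracket z x) = - bracket y (bracket x z)"
    using bracket_scale_right[of y "-1" "bracket x z"] bracket_antisym[of z x] by simp
  then have "bracket x (bracket y z) - bracket y (bracket x z) - bracket (bracket x y) z = 0"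
    using jacobi[of x y z] bracket_antisym[of z "bracket x y"] by simp
  then show ?thesis
    by (simp add: algebra_simps)
qed

lemma (in lie_algebra) bracket_sum_right: "bracket x (\<Sum>i\<in>I. v i) = (\<Sum>i\<in>I. bracket x (v i))"
  by (induction I rule: infinite_finite_induct) (simp_all add: bracket_add_right)

text \<open>When a simultaneous eigenvector for \<open>F\<close> is decomposed into eigenvectors of a further commuting
  \<open>ad y\<close>, the components are again eigenvectors for \<open>F\<close>: if \<open>ad z\<close> has eigenvalue \<open>a\<close> on the sum,
  \<open>ad z - a\<close> maps components to eigenvectors of \<open>ad y\<close> with the same eigenvalues and with sum zero,
  so all the images are zero.\<close>

lemma (in lie_algebra) simultaneous_eigenvectors_span:
  assumes "finite F" and comm: "\<And>x y. x \<in> F \<Longrightarrow> y \<in> F \<Longrightarrow> bracket x y = 0"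
    and diag: "\<And>y. y \<in> F \<Longrightarrow> span {x. \<exists>c. bracket y x = scale c x} = UNIV"
  shows "span {x. \<forall>y\<in>F. \<exists>c. bracket y x = scale c x} = UNIV"
  using assms
proof (induction F rule: finite_induct)
  case empty
  then show ?case by simp
next
  case (insert y F)
  let ?E = "{x. \<forall>z\<in>insert y F. \<exists>c. bracket z x = scale c x}"
  have IH: "span {x. \<forall>z\<in>F. \<exists>c. bracket z x = scale c x} = UNIV"
    using insert by simp
  have "x \<in> span ?E" if x: "\<forall>z\<in>F. \<exists>c. bracket z x = scale c x" for x
  proof -
    have "x \<in> span {x. \<exists>c. bracket y x = scale c x}"
      using insert.prems(2)[of y] by simp
    then obtain C v where C: "finite C" "\<forall>c\<in>C. bracket y (v c) = scale c (v c)" "x = (\<Sum>c\<in>C. v c)"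
      using eigenvector_decomposition[of "bracket y" x] bracket_add_right bracket_scale_right by metis
    have "v c \<in> ?E" if c: "c \<in> C" for c
    proof -
      have "\<exists>a. bracket z (v c) = scale a (v c)" if z: "z \<in> F" for z
      proof -
        obtain a where a: "bracket z x = scale a x" using x z by auto
        have "bracket z (v c) - scale a (v c) = 0"
        proof (rule eigenvectors_independent[where T = "bracket y" and I = C and ev = id])
          have "(\<Sum>c\<in>C. bracket z (v c) - scale a (v c)) = bracket z x - scale a x"
            by (simp add: C(3) bracket_sum_right scale_sum_right sum_subtractf)
          then show "(\<Sum>c\<in>C. bracket z (v c) - scale a (v c)) = 0" using a by simp
        next
          fix b assume b: "b \<in> C"
          have "bracket y (bracket z (v b)) = bracket z (bracket y (v b))"
            using bracket_bracket[of y z "v b"] insert.prems(1)[of y z] z by simp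
          also have "\<dots> = scale b (bracket z (v b))"
            using C(2) b by (simp add: bracket_scale_right)
          finally have "bracket y (bracket z (v b)) = scale b (bracket z (v b))" .
          moreover have "bracket y (u - w) = bracket y u - bracket y w" for u w
            using bracket_add_right[of y "u - w" w] by (simp add: algebra_simps)
          ultimately show "bracket y (bracket z (v b) - scale a (v b)) =
              scale (id b) (bracket z (v b) - scale a (v b))"
            using C(2) b by (simp add: bracket_scale_right scale_right_diff_distrib mult.commute)
        qed (use C(1) c in \<open>auto simp: bracket_add_right bracket_scale_right\<close>)
        then show ?thesis by auto
      qed
      then show ?thesis using C(2) c by auto
    qed
    then show ?thesis
      unfolding C(3) by (intro span_sum span_base) auto
  qed
  then have "span {x. \<forall>z\<in>F. \<exists>c. bracket z x = scale c x} \<subseteq> span ?E"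
    by (intro span_minimal) auto
  then show ?case using IH by auto
qed

section \<open>The form on the dual of a Cartan subalgebra\<close>

locale cartan_form = simple_lie_algebra scale bracket
  for scale :: "complex \<Rightarrow> 'g::ab_group_add \<Rightarrow> 'g" and bracket +
  fixes h :: "'g set" and B :: "'g \<Rightarrow> 'g \<Rightarrow> complex"
  assumes cartan: "cartan_subalgebra scale bracket h"
    and invariant: "invariant_form scale bracket B"
begin

abbreviation "h_dual \<equiv> dual_space scale h"
abbreviation "\<Phi> \<equiv> roots scale bracket h"
abbreviation "\<gg> \<equiv> root_space scale bracket h"
abbreviation "t \<equiv> riesz h B"
abbreviation "ip \<equiv> dual_form h B"

lemma subspace_h: "subspace h"
  and bracket_h: "x \<in> h \<Longrightarrow> y \<in> h \<Longrightarrow> bracket x y = 0"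
  and diag_h: "y \<in> h \<Longrightarrow> span {x. \<exists>c. bracket y x = scale c x} = UNIV"
  and centralizer_h: "(\<And>y. y \<in> h \<Longrightarrow> bracket x y = 0) \<Longrightarrow> x \<in> h"
  using cartan unfolding cartan_subalgebra_def by blast+

lemma B_add_left: "B (x + y) z = B x z + B y z"
  and B_scale_left: "B (scale c x) y = c * B x y"
  and B_sym: "B x y = B y x"
  and B_inv: "B (bracket x y) z = B x (bracket y z)"
  and B_nondeg: "(\<And>y. B x y = 0) \<Longrightarrow> x = 0"
  using invariant unfolding invariant_form_def by blast+

lemma B_add_right: "B z (x + y) = B z x + B z y"
  using B_add_left[of x y z] by (simp add: B_sym)

lemma B_scale_right: "B x (scale c y) = c * B x y"
  using B_scale_left[of c y x] by (simp add: B_sym)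

lemma B_zero_left [simp]: "B 0 x = 0"
  using B_scale_left[of 0 0 x] by simp

lemma B_zero_right [simp]: "B x 0 = 0"
  using B_scale_right[of x 0 0] by simp

lemma B_diff_left: "B (x - y) z = B x z - B y z"
  using B_add_left[of "x - y" y z] by simp

lemma B_zero_on_span:
  assumes "\<And>y. y \<in> S \<Longrightarrow> B x y = 0" "y \<in> span S"
  shows "B x y = 0"
  using assms(2)
  by (induction rule: span_induct_alt) (simp_all add: assms(1) B_add_right B_scale_right)

lemma h_basis:
  obtains F where "finite F" "F \<subseteq> h" "independent F" "span F = h"
proof -
  obtain S where S: "finite S" "span S = UNIV"
    using finite_dimensional by auto
  obtain F where F: "F \<subseteq> h" "independent F" "h \<subseteq> span F"
    using maximal_independent_subset by blast
  moreover have "finite F"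
    using independent_span_bound[OF S(1) F(2)] S(2) by simp
  moreover have "span F \<subseteq> h"
    using F(1) subspace_h by (rule span_minimal)
  ultimately show thesis
    using that by blast
qed

text \<open>It is enough to diagonalize a basis of \<open>h\<close> simultaneously, since the eigenvalue on a common
  eigenvector depends linearly on the element of \<open>h\<close>. The eigenvalue zero gives the centralizer of
  \<open>h\<close>, which is \<open>h\<close> itself.\<close>

lemma root_spaces_span: "span (h \<union> (\<Union>\<beta>\<in>\<Phi>. \<gg> \<beta>)) = UNIV"
proof -
  obtain F where F: "finite F" "F \<subseteq> h" "independent F" "span F = h"
    by (rule h_basis)
  let ?S = "h \<union> (\<Union>\<beta>\<in>\<Phi>. \<gg> \<beta>)"
  have "x \<in> ?S" if x: "\<forall>y\<in>F. \<exists>c. bracket y x = scale c x" for x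
  proof (cases "x = 0")
    case True
    then show ?thesis
      using subspace_h by (simp add: subspace_0)
  next
    case False
    have "\<exists>c. bracket y x = scale c x" if "y \<in> span F" for y
      using that
    proof (induction rule: span_induct_alt)
      case base
      show ?case by (intro exI[of _ 0]) simp
    next
      case (step k e y)
      then obtain c where "bracket e x = scale c x"
        using x by blast
      moreover obtain c' where "bracket y x = scale c' x"
        using step.IH by blast
      ultimately have "bracket (scale k e + y) x = scale (k * c + c') x"
        by (simp add: bracket_add_left bracket_scale_left scale_left_distrib)
      then show ?case by blast
    qed
    then obtain \<psi> where \<psi>: "\<And>y. y \<in> h \<Longrightarrow> bracket y x = scale (\<psi> y) x"
      using F(4) by metis
    define \<phi> where "\<phi> = (\<lambda>y. if y \<in> h then \<psi> y else 0)"
    have \<phi>: "bracket y x = scale (\<phi> y) x" if "y \<in> h" for y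
      using that \<psi> by (simp add: \<phi>_def)
    have "\<phi> \<in> h_dual"
      unfolding dual_space_def
    proof (intro CollectI conjI ballI allI impI)
      fix y z assume yz: "y \<in> h" "z \<in> h"
      then have "y + z \<in> h"
        using subspace_h by (simp add: subspace_add)
      then have "scale (\<phi> (y + z)) x = scale (\<phi> y + \<phi> z) x"
        using \<phi>[of y] \<phi>[of z] \<phi>[of "y + z"] yz
        by (simp add: scale_left_distrib bracket_add_left)
      then show "\<phi> (y + z) = \<phi> y + \<phi> z"
        using False by simp
    next
      fix c y assume y: "y \<in> h"
      then have "scale c y \<in> h"
        using subspace_h by (simp add: subspace_scale)
      then have "scale (\<phi> (scale c y)) x = scale (c * \<phi> y) x"
        using \<phi>[of y] \<phi>[of "scale c y"] y by (auto simp: bracket_scale_left)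
      then show "\<phi> (scale c y) = c * \<phi> y"
        using False by simp
    qed (simp add: \<phi>_def)
    moreover have x_in: "x \<in> \<gg> \<phi>"
      using \<phi> by (simp add: root_space_def)
    ultimately show ?thesis
    proof (cases "\<phi> = 0")
      case True
      then have "bracket x y = 0" if "y \<in> h" for y
        using \<phi>[OF that] bracket_antisym[of x y] by simp
      then have "x \<in> h" by (rule centralizer_h)
      then show ?thesis by simp
    next
      case nz: False
      then have "\<phi> \<in> \<Phi>"
        using \<open>\<phi> \<in> h_dual\<close> x_in False by (auto simp: roots_def)
      then show ?thesis
        using x_in by auto
    qed
  qed
  then have "{x. \<forall>y\<in>F. \<exists>c. bracket y x = scale c x} \<subseteq> ?S"
    by auto
  then have "span {x. \<forall>y\<in>F. \<exists>c. bracket y x = scale c x} \<subseteq> span ?S"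
    by (rule span_mono)
  moreover have "span {x. \<forall>y\<in>F. \<exists>c. bracket y x = scale c x} = UNIV"
    using F(1) by (rule simultaneous_eigenvectors_span) (use F(2) bracket_h diag_h in blast)+
  ultimately show ?thesis by auto
qed

lemma root_in_dual: "\<beta> \<in> \<Phi> \<Longrightarrow> \<beta> \<in> h_dual"
  by (simp add: roots_def)

lemma root_nonzero:
  assumes "\<beta> \<in> \<Phi>"
  obtains y where "y \<in> h" "\<beta> y \<noteq> 0"
proof -
  obtain y where "\<beta> y \<noteq> 0"
    using assms by (auto simp: roots_def fun_eq_iff)
  moreover from this have "y \<in> h"
    using assms by (auto simp: roots_def dual_space_def)
  ultimately show thesis
    using that by blast
qed

lemma root_spaceD: "x \<in> \<gg> \<phi> \<Longrightarrow> y \<in> h \<Longrightarrow> bracket y x = scale (\<phi> y) x"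
  by (simp add: root_space_def)

lemma root_space_0: "\<gg> 0 = h"
proof
  show "\<gg> 0 \<subseteq> h"
  proof
    fix x assume "x \<in> \<gg> 0"
    then have "bracket x y = 0" if "y \<in> h" for y
      using that root_spaceD[of x 0 y] bracket_antisym[of x y] by simp
    then show "x \<in> h" by (rule centralizer_h)
  qed
qed (auto simp: root_space_def bracket_h)

lemma subspace_root_space: "subspace (\<gg> \<phi>)"
  by (auto simp: subspace_def root_space_def bracket_add_right bracket_scale_right
      scale_right_distrib mult.commute)

text \<open>Invariance, \<open>B [x, y] z = B x [y, z]\<close>, reads \<open>- \<phi> y * B x z = \<psi> y * B x z\<close>.\<close>

lemma root_spaces_orthogonal:
  assumes "x \<in> \<gg> \<phi>" "z \<in> \<gg> \<psi>" "y \<in> h" "\<phi> y + \<psi> y \<noteq> 0"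
  shows "B x z = 0"
proof -
  have "B (bracket x y) z = B x (bracket y z)"
    by (rule B_inv)
  moreover have "bracket x y = scale (- \<phi> y) x"
    using root_spaceD[OF assms(1,3)] bracket_antisym[of x y] by simp
  ultimately have "- \<phi> y * B x z = \<psi> y * B x z"
    using root_spaceD[OF assms(2,3)] by (simp only: B_scale_left B_scale_right)
  then have "(\<phi> y + \<psi> y) * B x z = 0"
    by (simp add: ring_distribs eq_neg_iff_add_eq_0) (metis add.right_inverse)
  then show ?thesis
    using assms(4) by simp
qed

lemma h_orthogonal_root_space: "x \<in> h \<Longrightarrow> \<beta> \<in> \<Phi> \<Longrightarrow> e \<in> \<gg> \<beta> \<Longrightarrow> B x e = 0"
  by (metis root_nonzero root_space_0 root_spaces_orthogonal add_0 zero_fun_apply)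

lemma B_nondeg_h:
  assumes "x \<in> h" "\<And>y. y \<in> h \<Longrightarrow> B x y = 0"
  shows "x = 0"
proof (rule B_nondeg)
  fix y
  show "B x y = 0"
    by (rule B_zero_on_span[where S = "h \<union> (\<Union>\<beta>\<in>\<Phi>. \<gg> \<beta>)"])
      (use assms h_orthogonal_root_space root_spaces_span in auto)
qed

text \<open>The map sending \<open>x\<close> to the combination of a basis of \<open>h\<close> whose coefficients are the values of
  \<open>B x\<close> on that basis is injective on \<open>h\<close>, hence onto by dimension.\<close>

lemma riesz_exists:
  assumes "\<phi> \<in> h_dual"
  shows "\<exists>!r. r \<in> h \<and> (\<forall>x\<in>h. B r x = \<phi> x)"
proof -
  obtain F where F: "finite F" "F \<subseteq> h" "independent F" "span F = h"
    using h_basis by blast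
  obtain S where S: "finite S" "span S = UNIV"
    using finite_dimensional by auto
  obtain Bs where Bs: "independent Bs" "span Bs = UNIV" "finite Bs"
    using maximal_independent_subset[of UNIV] independent_span_bound[OF S(1)] S(2)
    by (metis UNIV_I subset_UNIV subset_antisym top_greatest)
  interpret V: finite_dimensional_vector_space_pair_1 scale Bs scale
    using Bs by unfold_locales
  define T where "T x = (\<Sum>b\<in>F. scale (B x b) b)" for x
  have lin: "Vector_Spaces.linear scale scale T"
    by unfold_locales
      (simp_all add: T_def B_add_left B_scale_left scale_left_distrib sum.distrib scale_sum_right)
  have coords: "(\<forall>b\<in>F. u b = w b)" if "(\<Sum>b\<in>F. scale (u b) b) = (\<Sum>b\<in>F. scale (w b) b)" for u w
  proof -
    have "(\<Sum>b\<in>F. scale (u b - w b) b) = 0"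
      using that by (simp add: scale_left_diff_distrib sum_subtractf)
    then have "\<forall>b\<in>F. u b - w b = 0"
      using independentD[OF F(3,1) order_refl, of "\<lambda>b. u b - w b"] by blast
    then show ?thesis by simp
  qed
  have agree: "\<forall>y\<in>h. B x y = \<psi> y"
    if "\<psi> \<in> h_dual" "\<forall>b\<in>F. B x b = \<psi> b" for x \<psi>
  proof
    have \<psi>: "\<psi> (y + z) = \<psi> y + \<psi> z" "\<psi> (scale c y) = c * \<psi> y"
      if "y \<in> h" "z \<in> h" for c y z
      using \<open>\<psi> \<in> h_dual\<close> that by (auto simp: dual_space_def)
    fix y assume "y \<in> h"
    have *: "B x y = \<psi> y \<and> y \<in> h" if "y \<in> span F"
      using that
    proof (induction rule: span_induct_alt)
      case base
      have "\<psi> (scale 0 0) = 0 * \<psi> 0"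
        using \<psi>(2) subspace_h subspace_0 by blast
      then show ?case using subspace_h by (simp add: subspace_0)
    next
      case (step k e y)
      then have "e \<in> h" "scale k e \<in> h" "y \<in> h"
        using F(2) subspace_h by (auto intro: subspace_scale)
      then show ?case
        using step \<open>\<forall>b\<in>F. B x b = \<psi> b\<close> \<psi>[of "scale k e" y] \<psi>(2)[of e e k] subspace_h
        by (simp add: B_add_right B_scale_right subspace_add)
    qed
    then show "B x y = \<psi> y"
      using \<open>y \<in> h\<close> F(4) by simp
  qed
  have zero_dual: "0 \<in> h_dual"
    by (simp add: dual_space_def)
  have "inj_on T h"
  proof (rule inj_onI)
    fix x y assume xy: "x \<in> h" "y \<in> h" "T x = T y"
    then have "\<forall>b\<in>F. B (x - y) b = 0 b"
      using coords by (auto simp: T_def B_diff_left)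
    then have "\<forall>z\<in>h. B (x - y) z = 0"
      using agree[OF zero_dual] by simp
    moreover have "x - y \<in> h"
      using xy subspace_h by (simp add: subspace_diff)
    ultimately show "x = y"
      using B_nondeg_h[of "x - y"] by simp
  qed
  have "T ` h = h"
  proof -
    have "T ` h \<subseteq> h"
      using F subspace_h by (auto simp: T_def intro!: subspace_sum subspace_scale)
    moreover have "dim (T ` h) = dim h"
      using V.dim_image_eq[OF lin, of h] \<open>inj_on T h\<close> span_eq_iff[THEN iffD2, OF subspace_h] by simp
    moreover have "subspace (T ` h)"
      using module_hom.subspace_image[OF lin[unfolded module_hom_eq_linear[symmetric]] subspace_h] .
    ultimately show ?thesis
      using V.vs1.subspace_dim_equal[of "T ` h" h] subspace_h by simp
  qed
  moreover have "(\<Sum>b\<in>F. scale (\<phi> b) b) \<in> h"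
    using F(2) subspace_h by (auto intro!: subspace_sum subspace_scale)
  ultimately obtain r where r: "r \<in> h" "T r = (\<Sum>b\<in>F. scale (\<phi> b) b)"
    by (metis imageE)
  then have "\<forall>b\<in>F. B r b = \<phi> b"
    using coords by (simp add: T_def)
  then have r': "\<forall>x\<in>h. B r x = \<phi> x"
    using agree assms by blast
  show ?thesis
  proof (rule ex1I)
    show "r \<in> h \<and> (\<forall>x\<in>h. B r x = \<phi> x)"
      using r r' by simp
    show "r' = r" if "r' \<in> h \<and> (\<forall>x\<in>h. B r' x = \<phi> x)" for r'
      using that r r' B_nondeg_h[of "r' - r"] subspace_h by (simp add: B_diff_left subspace_diff)
  qed
qed

lemma riesz_in_h: "\<phi> \<in> h_dual \<Longrightarrow> t \<phi> \<in> h"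
  and B_riesz: "\<phi> \<in> h_dual \<Longrightarrow> x \<in> h \<Longrightarrow> B (t \<phi>) x = \<phi> x"
  using theI'[OF riesz_exists, of \<phi>] by (simp_all add: riesz_def)

lemma riesz_unique: "\<phi> \<in> h_dual \<Longrightarrow> r \<in> h \<Longrightarrow> (\<And>x. x \<in> h \<Longrightarrow> B r x = \<phi> x) \<Longrightarrow> r = t \<phi>"
  using riesz_exists[of \<phi>] riesz_in_h[of \<phi>] B_riesz[of \<phi>] by auto

lemma ip_eq: "\<phi> \<in> h_dual \<Longrightarrow> \<psi> \<in> h_dual \<Longrightarrow> ip \<phi> \<psi> = \<phi> (t \<psi>)"
  by (simp add: dual_form_def B_riesz riesz_in_h)

lemma ip_sym: "ip \<phi> \<psi> = ip \<psi> \<phi>"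
  by (simp add: dual_form_def B_sym)

lemma dual_add: "\<phi> \<in> h_dual \<Longrightarrow> \<psi> \<in> h_dual \<Longrightarrow> \<phi> + \<psi> \<in> h_dual"
  by (auto simp: dual_space_def algebra_simps)

lemma dual_scale: "\<phi> \<in> h_dual \<Longrightarrow> (\<lambda>x. c * \<phi> x) \<in> h_dual"
  by (auto simp: dual_space_def algebra_simps)

lemma dual_zero: "0 \<in> h_dual"
  by (simp add: dual_space_def)

lemma dual_sum: "(\<And>i. i \<in> I \<Longrightarrow> v i \<in> h_dual) \<Longrightarrow> (\<lambda>x. \<Sum>i\<in>I. c i * v i x) \<in> h_dual"
proof (induction I rule: infinite_finite_induct)
  case (insert j I)
  then show ?case
    using dual_add[of "\<lambda>x. c j * v j x" "\<lambda>x. \<Sum>i\<in>I. c i * v i x"] dual_scale[of "v j" "c j"]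
    by (simp add: plus_fun_def)
qed (use dual_zero in \<open>simp_all add: zero_fun_def\<close>)

lemma ip_sum_left:
  assumes "\<And>i. i \<in> I \<Longrightarrow> v i \<in> h_dual" "\<psi> \<in> h_dual"
  shows "ip (\<lambda>x. \<Sum>i\<in>I. c i * v i x) \<psi> = (\<Sum>i\<in>I. c i * ip (v i) \<psi>)"
  using assms by (simp add: ip_eq dual_sum)

lemma ip_add_left:
  assumes "\<phi> \<in> h_dual" "\<phi>' \<in> h_dual" "\<psi> \<in> h_dual"
  shows "ip (\<phi> + \<phi>') \<psi> = ip \<phi> \<psi> + ip \<phi>' \<psi>"
  using assms by (simp add: ip_eq dual_add)

text \<open>Every \<open>y \<in> h\<close> represents some functional, namely \<open>B y\<close>, so \<open>\<phi> y\<close> is a value of the form.\<close>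

lemma ip_nondeg:
  assumes "\<phi> \<in> h_dual" "\<And>\<psi>. \<psi> \<in> h_dual \<Longrightarrow> ip \<phi> \<psi> = 0"
  shows "\<phi> = 0"
proof -
  have "\<phi> y = 0" if y: "y \<in> h" for y
  proof -
    define \<psi> where "\<psi> = (\<lambda>x. if x \<in> h then B y x else 0)"
    have "\<psi> \<in> h_dual"
      using subspace_h by (auto simp: \<psi>_def dual_space_def B_add_right B_scale_right subspace_add subspace_scale)
    moreover have "y = t \<psi>"
      using y by (intro riesz_unique \<open>\<psi> \<in> h_dual\<close>) (simp_all add: \<psi>_def)
    ultimately show ?thesis
      using assms ip_eq by metis
  qed
  moreover have "\<phi> y = 0" if "y \<notin> h" for y
    using that assms(1) by (simp add: dual_space_def)
  ultimately show ?thesis by (auto simp: fun_eq_iff)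
qed

section \<open>Rationality of root lengths\<close>

lemma bracket_root_spaces:
  assumes "x \<in> \<gg> \<phi>" "y \<in> \<gg> \<psi>"
  shows "bracket x y \<in> \<gg> (\<phi> + \<psi>)"
  using assms
  by (auto simp: root_space_def bracket_bracket[of _ x y] bracket_scale_left bracket_scale_right
      scale_left_distrib)

text \<open>Both sides lie in \<open>h\<close> and pair with \<open>z \<in> h\<close> to \<open>\<phi> z * B x y\<close>.\<close>

lemma bracket_opposite_root_spaces:
  assumes "\<phi> \<in> h_dual" "x \<in> \<gg> \<phi>" "y \<in> \<gg> (- \<phi>)"
  shows "bracket x y = scale (B x y) (t \<phi>)"
proof -
  have xy: "bracket x y \<in> h"
    using bracket_root_spaces[OF assms(2,3)] by (simp add: root_space_0)
  have th: "scale (B x y) (t \<phi>) \<in> h"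
    using subspace_h riesz_in_h[OF assms(1)] by (simp add: subspace_scale)
  have "B (bracket x y - scale (B x y) (t \<phi>)) z = 0" if z: "z \<in> h" for z
  proof -
    have "bracket y z = scale (\<phi> z) y"
      using root_spaceD[OF assms(3) z] bracket_antisym[of y z] by simp
    then have "B (bracket x y) z = \<phi> z * B x y"
      by (simp only: B_inv B_scale_right)
    then show ?thesis
      using B_riesz[OF assms(1) z] by (simp add: B_diff_left B_scale_left)
  qed
  then show ?thesis
    using B_nondeg_h[of "bracket x y - scale (B x y) (t \<phi>)"] xy th subspace_h
    by (simp add: subspace_diff)
qed

text \<open>The space of \<open>\<alpha>\<close> is orthogonal to \<open>h\<close> and to all root spaces but that of \<open>- \<alpha>\<close>, so
  non-degeneracy produces \<open>f\<close> there. When \<open>(\<alpha>, \<alpha>) \<noteq> 0\<close>, the vectors \<open>e\<close>, \<open>f\<close> and \<open>[e, f] = t \<alpha>\<close> span a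
  copy of \<open>sl\<^sub>2\<close>.\<close>

lemma opposite_root_vector:
  assumes \<alpha>: "\<alpha> \<in> \<Phi>" and e: "e \<in> \<gg> \<alpha>" "e \<noteq> 0"
  obtains f where "f \<in> \<gg> (- \<alpha>)" "B e f = 1"
proof -
  obtain z where "B e z \<noteq> 0"
    using B_nondeg e(2) by blast
  then obtain y where y: "y \<in> h \<union> (\<Union>\<beta>\<in>\<Phi>. \<gg> \<beta>)" "B e y \<noteq> 0"
    using B_zero_on_span[of "h \<union> (\<Union>\<beta>\<in>\<Phi>. \<gg> \<beta>)" e z] root_spaces_span by auto
  have "y \<notin> h"
    using y(2) h_orthogonal_root_space[OF _ \<alpha> e(1)] by (auto simp: B_sym[of e])
  then obtain \<beta> where \<beta>: "\<beta> \<in> \<Phi>" "y \<in> \<gg> \<beta>"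
    using y(1) by auto
  have "\<beta> = - \<alpha>"
  proof
    fix z
    show "\<beta> z = (- \<alpha>) z"
    proof (cases "z \<in> h")
      case True
      then have "\<alpha> z + \<beta> z = 0"
        using root_spaces_orthogonal[OF e(1) \<beta>(2)] y(2) by blast
      then show ?thesis
        by (simp add: add_eq_0_iff)
    next
      case False
      then show ?thesis
        using root_in_dual[OF \<alpha>] root_in_dual[OF \<beta>(1)] by (simp add: dual_space_def)
    qed
  qed
  then have "scale (1 / B e y) y \<in> \<gg> (- \<alpha>)"
    using \<beta>(2) subspace_root_space by (simp add: subspace_scale)
  moreover have "B e (scale (1 / B e y) y) = 1"
    using y(2) by (simp add: B_scale_right)
  ultimately show thesis
    using that by blast
qed

lemma ladder_eigenvalue:
  assumes "bracket r e = scale a e" "bracket r x = scale b x"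
  shows "bracket r ((bracket e ^^ k) x) = scale (b + of_nat k * a) ((bracket e ^^ k) x)"
proof (induction k)
  case (Suc k)
  then show ?case
    using assms(1)
    by (simp add: bracket_bracket[of r e] bracket_scale_left bracket_scale_right
        algebra_simps flip: scale_left_distrib)
qed (simp add: assms)

lemma ladder_top:
  assumes "bracket r e = scale a e" "bracket r x = scale b x" "a \<noteq> 0" "x \<noteq> 0"
  obtains k where "(bracket e ^^ k) x \<noteq> 0" "(bracket e ^^ Suc k) x = 0"
proof -
  obtain S where S: "finite S" "span S = UNIV"
    using finite_dimensional by auto
  have "\<exists>k. (bracket e ^^ k) x = 0"
    by (rule eigenvector_sequence_vanishes[OF _ _ S, where T = "bracket r" and ev = "\<lambda>k. b + of_nat k * a"])
      (use ladder_eigenvalue[OF assms(1,2)] assms(3) in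
        \<open>auto simp: bracket_add_right bracket_scale_right inj_on_def\<close>)
  then obtain m where "(bracket e ^^ m) x = 0" by blast
  then obtain k where "k < m" "\<forall>i\<le>k. (bracket e ^^ i) x \<noteq> 0" "(bracket e ^^ (k + 1)) x = 0"
    using ex_least_nat_less[of "\<lambda>k. (bracket e ^^ k) x = 0" m] assms(4) by auto
  then show thesis
    using that[of k] by auto
qed

text \<open>The commutation rule of \<open>sl\<^sub>2\<close> for a highest weight vector \<open>v\<close>, in the unscaled normalization where
  \<open>e\<close> has eigenvalue \<open>a\<close> under \<open>r = [e, f]\<close> instead of \<open>2\<close>.\<close>

lemma sl2_lowering:
  assumes "bracket e f = r" "bracket r f = scale (- a) f" "bracket r v = scale c v" "bracket e v = 0"
  shows "bracket e ((bracket f ^^ Suc j) v)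
    = scale (of_nat (Suc j) * (c - of_nat j * a / 2)) ((bracket f ^^ j) v)"
proof (induction j)
  case 0
  then show ?case
    using assms by (simp add: bracket_bracket[of e f])
next
  case (Suc j)
  have "bracket e ((bracket f ^^ Suc (Suc j)) v) =
      bracket r ((bracket f ^^ Suc j) v) + bracket f (bracket e ((bracket f ^^ Suc j) v))"
    using assms(1) by (simp add: bracket_bracket[of e f])
  also have "\<dots> = scale (c - of_nat (Suc j) * a) ((bracket f ^^ Suc j) v)
      + scale (of_nat (Suc j) * (c - of_nat j * a / 2)) ((bracket f ^^ Suc j) v)"
    unfolding Suc ladder_eigenvalue[OF assms(2,3)] bracket_scale_right by simp
  also have "\<dots> = scale (of_nat (Suc (Suc j)) * (c - of_nat (Suc j) * a / 2)) ((bracket f ^^ Suc j) v)"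
    unfolding scale_left_distrib[symmetric]
    by (rule arg_cong[of _ _ "\<lambda>c. scale c _"]) (simp add: field_simps)
  finally show ?case .
qed

text \<open>Raise a root vector for \<open>\<beta>\<close> by \<open>e\<close> until it reaches a highest weight vector \<open>v\<close>, say after \<open>k\<close>
  steps, and lower \<open>v\<close> by \<open>f\<close> until it dies, after \<open>m + 1\<close> steps. The commutation rule then forces the
  eigenvalue of \<open>v\<close> to be \<open>m (\<alpha>, \<alpha>) / 2\<close>, while it is \<open>(\<beta>, \<alpha>) + k (\<alpha>, \<alpha>)\<close> by construction.\<close>

lemma cartan_integer:
  assumes \<alpha>: "\<alpha> \<in> \<Phi>" and \<beta>: "\<beta> \<in> \<Phi>" and nz: "ip \<alpha> \<alpha> \<noteq> 0"
  obtains k :: int where "2 * ip \<beta> \<alpha> = of_int k * ip \<alpha> \<alpha>"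
proof -
  define a where "a = ip \<alpha> \<alpha>"
  have root_vector: "\<exists>x. x \<in> \<gg> \<gamma> \<and> x \<noteq> 0" if "\<gamma> \<in> \<Phi>" for \<gamma>
    using that subspace_0[OF subspace_root_space[of \<gamma>]] by (auto simp: roots_def)
  obtain e where e: "e \<in> \<gg> \<alpha>" "e \<noteq> 0"
    using root_vector[OF \<alpha>] by blast
  obtain f where f: "f \<in> \<gg> (- \<alpha>)" "B e f = 1"
    using opposite_root_vector[OF \<alpha> e] by blast
  obtain x where x: "x \<in> \<gg> \<beta>" "x \<noteq> 0"
    using root_vector[OF \<beta>] by blast
  have t: "t \<alpha> \<in> h"
    using riesz_in_h root_in_dual \<alpha> by blast
  have ef: "bracket e f = t \<alpha>"
    using bracket_opposite_root_spaces[OF root_in_dual[OF \<alpha>] e(1) f(1)] f(2) by simp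
  have te: "bracket (t \<alpha>) e = scale a e"
    using root_spaceD[OF e(1) t] \<alpha> by (simp add: a_def ip_eq root_in_dual)
  have tf: "bracket (t \<alpha>) f = scale (- a) f"
    using root_spaceD[OF f(1) t] \<alpha> by (simp add: a_def ip_eq root_in_dual)
  have tx: "bracket (t \<alpha>) x = scale (ip \<beta> \<alpha>) x"
    using root_spaceD[OF x(1) t] \<alpha> \<beta> by (simp add: ip_eq root_in_dual)
  obtain k where k: "(bracket e ^^ k) x \<noteq> 0" "(bracket e ^^ Suc k) x = 0"
    using ladder_top[OF te tx _ x(2)] nz by (auto simp: a_def)
  define v where "v = (bracket e ^^ k) x"
  define c where "c = ip \<beta> \<alpha> + of_nat k * a"
  have v: "bracket (t \<alpha>) v = scale c v" "bracket e v = 0" "v \<noteq> 0"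
    using ladder_eigenvalue[OF te tx] k by (auto simp: v_def c_def)
  obtain m where m: "(bracket f ^^ m) v \<noteq> 0" "(bracket f ^^ Suc m) v = 0"
    using ladder_top[OF tf v(1) _ v(3)] nz by (auto simp: a_def)
  have "scale (of_nat (Suc m) * (c - of_nat m * a / 2)) ((bracket f ^^ m) v) = 0"
    using sl2_lowering[OF ef tf v(1,2), of m] m(2) by simp
  then have "of_nat (Suc m) * (c - of_nat m * a / 2) = 0"
    using m(1) by (simp del: of_nat_Suc)
  then have "c - of_nat m * a / 2 = 0"
    by (simp del: of_nat_Suc)
  then have "2 * ip \<beta> \<alpha> = of_int (int m - 2 * int k) * ip \<alpha> \<alpha>"
    by (simp add: c_def a_def field_simps)
  then show thesis by (rule that)
qed

text \<open>Both \<open>2 (\<beta>, \<alpha>) / (\<alpha>, \<alpha>)\<close> and \<open>2 (\<alpha>, \<beta>) / (\<beta>, \<beta>)\<close> are non-zero integers, and their quotient is the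
  ratio of the two lengths.\<close>

lemma root_length_rational_if_not_orthogonal:
  assumes "\<alpha> \<in> \<Phi>" "\<beta> \<in> \<Phi>" "ip \<alpha> \<alpha> \<noteq> 0" "ip \<beta> \<beta> \<noteq> 0" "ip \<beta> \<alpha> \<noteq> 0" "ip \<alpha> \<alpha> \<in> \<rat>"
  shows "ip \<beta> \<beta> \<in> \<rat>"
proof -
  obtain k :: int where k: "2 * ip \<beta> \<alpha> = of_int k * ip \<alpha> \<alpha>"
    using cartan_integer assms by blast
  obtain m :: int where m: "2 * ip \<alpha> \<beta> = of_int m * ip \<beta> \<beta>"
    using cartan_integer assms by blast
  have "m \<noteq> 0"
    using m assms(5) by (auto simp: ip_sym[of \<alpha>])
  moreover have "of_int m * ip \<beta> \<beta> = of_int k * ip \<alpha> \<alpha>"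
    using k m ip_sym[of \<alpha> \<beta>] by simp
  ultimately have "ip \<beta> \<beta> = of_int k * ip \<alpha> \<alpha> / of_int m"
    by (simp add: eq_divide_eq mult.commute)
  then show ?thesis
    using assms(6) by simp
qed

text \<open>Let \<open>P\<close> consist of the roots of rational length. It is orthogonal to the remaining roots, so the
  root vectors for \<open>P\<close> and the elements \<open>t \<beta>\<close> with \<open>\<beta> \<in> P\<close> span an ideal. It contains the root space of
  \<open>\<delta>\<close>, so by simplicity it is everything. For a root \<open>\<gamma>\<close> outside \<open>P\<close>, the element \<open>t \<gamma>\<close> commutes with this ideal, but it acts
  on the root space of \<open>\<gamma>\<close> by \<open>(\<gamma>, \<gamma>) \<noteq> 0\<close>.\<close>

lemma root_lengths_rational:
  assumes nz: "\<And>\<beta>. \<beta> \<in> \<Phi> \<Longrightarrow> ip \<beta> \<beta> \<noteq> 0" and \<delta>: "\<delta> \<in> \<Phi>" "ip \<delta> \<delta> \<in> \<rat>" and \<gamma>: "\<gamma> \<in> \<Phi>"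
  shows "ip \<gamma> \<gamma> \<in> \<rat>"
proof (rule ccontr)
  assume irr: "ip \<gamma> \<gamma> \<notin> \<rat>"
  define P where "P = {\<beta> \<in> \<Phi>. ip \<beta> \<beta> \<in> \<rat>}"
  have orth: "ip \<beta> \<beta>' = 0" if "\<beta> \<in> \<Phi> - P" "\<beta>' \<in> P" for \<beta> \<beta>'
    using that root_length_rational_if_not_orthogonal[of \<beta>' \<beta>] nz by (auto simp: P_def)
  have dual: "\<beta> \<in> h_dual" if "\<beta> \<in> P" for \<beta>
    using that root_in_dual by (simp add: P_def)
  define S where "S = t ` P \<union> (\<Union>\<beta>\<in>P. \<gg> \<beta>)"
  have S1: "scale c x \<in> span S" if "x \<in> S" for c x
    using that by (simp add: span_base span_scale)
  \<comment> \<open>Stability of the span on generators of both factors; linearity in each factor extends it.\<close>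
  have gen: "bracket x y \<in> span S" if y: "y \<in> S" and x: "x \<in> h \<union> (\<Union>\<beta>\<in>\<Phi>. \<gg> \<beta>)" for x y
  proof -
    consider (t) \<beta> where "\<beta> \<in> P" "y = t \<beta>" | (g) \<beta> where "\<beta> \<in> P" "y \<in> \<gg> \<beta>"
      using y by (auto simp: S_def)
    then show ?thesis
    proof cases
      case t
      then have yh: "y \<in> h"
        using riesz_in_h dual by simp
      from x consider "x \<in> h" | \<eta> where "\<eta> \<in> \<Phi>" "x \<in> \<gg> \<eta>" by auto
      then show ?thesis
      proof cases
        case 1
        then show ?thesis using yh by (simp add: bracket_h span_zero)
      next
        case 2
        then have xy: "bracket x y = scale (- ip \<eta> \<beta>) x"
          using root_spaceD[OF 2(2) yh] bracket_antisym[of x y] t dual by (simp add: ip_eq root_in_dual)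
        show ?thesis
        proof (cases "\<eta> \<in> P")
          case True
          then show ?thesis
            unfolding xy using 2 by (intro S1) (auto simp: S_def)
        next
          case False
          then show ?thesis
            unfolding xy using 2 t orth by (simp add: span_zero)
        qed
      qed
    next
      case g
      from x consider "x \<in> h" | \<eta> where "\<eta> \<in> \<Phi>" "x \<in> \<gg> \<eta>" by auto
      then show ?thesis
      proof cases
        case 1
        then show ?thesis using root_spaceD[OF g(2)] y S1 by simp
      next
        case 2
        have xy: "bracket x y \<in> \<gg> (\<eta> + \<beta>)"
          using bracket_root_spaces 2 g by blast
        consider "\<eta> + \<beta> = 0" | "bracket x y = 0" | "\<eta> + \<beta> \<noteq> 0" "bracket x y \<noteq> 0" by blast
        then show ?thesis
        proof cases
          case 1
          then have "\<eta> = - \<beta>"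
            by (simp add: eq_neg_iff_add_eq_0)
          then have "bracket x y = scale (- B y x) (t \<beta>)"
            using bracket_opposite_root_spaces[OF dual[OF g(1)] g(2)] 2 bracket_antisym[of x y] by simp
          moreover have "t \<beta> \<in> S"
            using g(1) by (simp add: S_def)
          ultimately show ?thesis
            by (simp only: S1)
        next
          case 3
          have \<eta>: "\<eta> \<in> h_dual" and \<beta>: "\<beta> \<in> h_dual"
            using 2 root_in_dual dual g by auto
          have sum: "\<eta> + \<beta> \<in> \<Phi>"
            using 3 xy dual_add[OF \<eta> \<beta>] by (auto simp: roots_def)
          \<comment> \<open>Otherwise \<open>\<eta> + \<beta>\<close> is orthogonal to \<open>\<beta>\<close>. If also \<open>\<eta> \<in> P\<close>, it is orthogonal to itself; if
            not, \<open>\<eta>\<close> and hence \<open>\<beta>\<close> is orthogonal to \<open>\<beta>\<close>.\<close>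
          have "\<eta> + \<beta> \<in> P"
          proof (rule ccontr)
            assume "\<eta> + \<beta> \<notin> P"
            then have o: "ip (\<eta> + \<beta>) \<xi> = 0" if "\<xi> \<in> P" for \<xi>
              using orth sum that by blast
            show False
            proof (cases "\<eta> \<in> P")
              case True
              have "ip (\<eta> + \<beta>) (\<eta> + \<beta>) = ip (\<eta> + \<beta>) \<eta> + ip (\<eta> + \<beta>) \<beta>"
                using ip_add_left[OF \<eta> \<beta> dual_add[OF \<eta> \<beta>]] 
                by (simp only: ip_sym[of \<eta> "\<eta> + \<beta>"] ip_sym[of \<beta> "\<eta> + \<beta>"])
              then show False
                using o True g(1) nz[OF sum] by simp
            next
              case False
              then have "ip \<beta> \<beta> = 0"
                using o[OF g(1)] orth[of \<eta> \<beta>] 2 g(1) ip_add_left[OF \<eta> \<beta> \<beta>] by simp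
              then show False
                using nz g(1) by (simp add: P_def)
            qed
          qed
          then show ?thesis
            using xy by (intro span_base) (auto simp: S_def)
        qed (simp add: span_zero)
      qed
    qed
  qed
  have gen': "bracket x y \<in> span S" if "y \<in> S" for x y
  proof -
    have "x \<in> span (h \<union> (\<Union>\<beta>\<in>\<Phi>. \<gg> \<beta>))"
      using root_spaces_span by simp
    then show ?thesis
      by (induction rule: span_induct_alt)
        (use gen[OF that] in \<open>simp_all add: span_zero span_add span_scale bracket_add_left bracket_scale_left\<close>)
  qed
  have "bracket x y \<in> span S" if "y \<in> span S" for x y
    using that
    by (induction rule: span_induct_alt)
      (use gen' in \<open>simp_all add: span_zero span_add span_scale bracket_add_right bracket_scale_right\<close>)
  then have "span S = {0} \<or> span S = UNIV"
    using no_proper_ideal subspace_span by blast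
  moreover obtain d where "d \<in> \<gg> \<delta>" "d \<noteq> 0"
    using \<delta>(1) subspace_0[OF subspace_root_space[of \<delta>]] by (auto simp: roots_def)
  moreover from this have "d \<in> span S"
    using \<delta> by (intro span_base) (auto simp: S_def P_def)
  ultimately have UNIV: "span S = UNIV" by auto
  have \<gamma>': "\<gamma> \<in> \<Phi> - P" "\<gamma> \<in> h_dual"
    using \<gamma> irr root_in_dual by (auto simp: P_def)
  have zero: "bracket (t \<gamma>) y = 0" for y
  proof -
    have "bracket (t \<gamma>) y = 0" if "y \<in> S" for y
    proof -
      consider (t) \<beta> where "\<beta> \<in> P" "y = t \<beta>" | (g) \<beta> where "\<beta> \<in> P" "y \<in> \<gg> \<beta>"
        using \<open>y \<in> S\<close> by (auto simp: S_def)
      then show ?thesis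
      proof cases
        case t
        then show ?thesis
          using riesz_in_h dual \<gamma>' bracket_h by simp
      next
        case g
        then have "bracket (t \<gamma>) y = scale (ip \<gamma> \<beta>) y"
          using root_spaceD[OF g(2) riesz_in_h[OF \<gamma>'(2)]] \<gamma>' dual
          by (simp add: ip_eq ip_sym[of \<gamma>])
        then show ?thesis
          using orth[OF \<gamma>'(1) g(1)] by simp
      qed
    qed
    note gens = this
    have "y \<in> span S" using UNIV by simp
    then show ?thesis
      by (induction rule: span_induct_alt)
        (simp_all add: gens bracket_add_right bracket_scale_right)
  qed
  obtain e where "e \<in> \<gg> \<gamma>" "e \<noteq> 0"
    using \<gamma> subspace_0[OF subspace_root_space[of \<gamma>]] by (auto simp: roots_def)
  then have "scale (ip \<gamma> \<gamma>) e = 0"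
    using root_spaceD[of e \<gamma> "t \<gamma>"] zero \<gamma>' riesz_in_h by (simp add: ip_eq)
  then show False
    using \<open>e \<noteq> 0\<close> nz \<gamma> by simp
qed

lemma ip_roots_rational:
  assumes "\<And>\<beta>. \<beta> \<in> \<Phi> \<Longrightarrow> ip \<beta> \<beta> \<noteq> 0" "\<delta> \<in> \<Phi>" "ip \<delta> \<delta> \<in> \<rat>" "\<alpha> \<in> \<Phi>" "\<beta> \<in> \<Phi>"
  shows "ip \<beta> \<alpha> \<in> \<rat>"
proof -
  obtain k :: int where "2 * ip \<beta> \<alpha> = of_int k * ip \<alpha> \<alpha>"
    using cartan_integer assms by blast
  then have "ip \<beta> \<alpha> = of_int k * ip \<alpha> \<alpha> / 2"
    by (simp add: eq_divide_eq mult.commute)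
  moreover have "ip \<alpha> \<alpha> \<in> \<rat>"
    using assms(1-4) by (rule root_lengths_rational)
  ultimately show ?thesis
    by (simp only: Rats_mult Rats_divide Rats_of_int Rats_number_of)
qed

end

section \<open>Finiteness of the quotients by the centralizer\<close>

text \<open>A linear functional over the rationals turns a complex solution of a linear system with rational
  coefficients into a rational one.\<close>

lemma rational_projection:
  obtains p :: "complex \<Rightarrow> complex"
  where "\<And>x y. p (x + y) = p x + p y" "\<And>q x. q \<in> \<rat> \<Longrightarrow> p (q * x) = q * p x"
    "\<And>x. p x \<in> \<rat>" "p 1 = 1"
proof -
  define s1 where "s1 q z = of_rat q * z" for q :: rat and z :: complex
  define s2 where "s2 q r = q * r" for q r :: rat
  interpret V: vector_space_pair s1 s2
    by unfold_locales (simp_all add: s1_def s2_def algebra_simps of_rat_add of_rat_mult)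
  have "V.vs1.independent {1}"
    using V.vs1.independent_insert[of 1 "{}"] by simp
  then obtain f where f: "Vector_Spaces.linear s1 s2 f" "f 1 = 1"
    using V.linear_independent_extend[of "{1}" "\<lambda>_. 1"] by auto
  interpret f: Vector_Spaces.linear s1 s2 f by (rule f(1))
  show thesis
  proof (rule that[of "\<lambda>z. of_rat (f z)"])
    show "of_rat (f (x + y)) = (of_rat (f x) + of_rat (f y) :: complex)" for x y
      by (simp add: f.add of_rat_add)
    show "of_rat (f (q * x)) = q * (of_rat (f x) :: complex)" if "q \<in> \<rat>" for q x
    proof -
      from that obtain r where "q = of_rat r" by (auto elim: Rats_cases)
      then show ?thesis
        using f.scale[of r x] by (simp add: s1_def s2_def of_rat_mult)
    qed
  qed (simp_all add: f(2))
qed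

lemma common_denominator:
  fixes q :: "'i \<Rightarrow> complex"
  assumes "finite I" "\<And>i. i \<in> I \<Longrightarrow> q i \<in> \<rat>"
  obtains N :: nat where "N > 0" "\<And>i. i \<in> I \<Longrightarrow> \<exists>k::int. of_nat N * q i = of_int k"
proof -
  have "\<exists>N>0. \<forall>i\<in>I. \<exists>k::int. of_nat N * q i = of_int k"
    using assms
  proof (induction I rule: finite_induct)
    case (insert j I)
    then obtain N where N: "N > 0" "\<forall>i\<in>I. \<exists>k::int. of_nat N * q i = of_int k" by auto
    obtain a b :: int where ab: "b > 0" "q j = of_int a / of_int b"
      using insert.prems[of j] by (auto elim!: Rats_cases')
    have "of_nat (N * nat b) * q j = of_int (int N * a)"
      using ab by simp
    moreover have "\<exists>k::int. of_nat (N * nat b) * q i = of_int k" if "i \<in> I" for i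
    proof -
      from N(2) that obtain k :: int where "of_nat N * q i = of_int k" by blast
      then have "of_nat (N * nat b) * q i = of_int (b * k)"
        using ab(1) by (simp add: mult_ac)
      then show ?thesis by blast
    qed
    ultimately have "\<forall>i\<in>insert j I. \<exists>k::int. of_nat (N * nat b) * q i = of_int k"
      by blast
    moreover have "N * nat b > 0"
      using N(1) ab(1) by simp
    ultimately show ?case by blast
  qed auto
  then show thesis
    using that by blast
qed

lemma int_spanI: "(\<lambda>x. \<Sum>i=1..n. of_int (c i) * v i x) \<in> int_span n v"
  by (auto simp: int_span_def)

lemma lattice_int_span: "is_lattice (int_span n v)"
proof (rule latticeI)
  show "0 \<in> int_span n v"
    using int_spanI[of "\<lambda>_. 0" v n] by (simp add: zero_fun_def)
  show "x + y \<in> int_span n v" if "x \<in> int_span n v" "y \<in> int_span n v" for x y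
  proof -
    from that obtain c d where "x = (\<lambda>z. \<Sum>i=1..n. of_int (c i) * v i z)"
      "y = (\<lambda>z. \<Sum>i=1..n. of_int (d i) * v i z)"
      by (auto simp: int_span_def)
    then have "x + y = (\<lambda>z. \<Sum>i=1..n. of_int (c i + d i) * v i z)"
      by (simp add: plus_fun_def sum.distrib ring_distribs)
    then show ?thesis using int_spanI by metis
  qed
  show "- x \<in> int_span n v" if "x \<in> int_span n v" for x
  proof -
    from that obtain c where "x = (\<lambda>z. \<Sum>i=1..n. of_int (c i) * v i z)"
      by (auto simp: int_span_def)
    then have "- x = (\<lambda>z. \<Sum>i=1..n. of_int (- c i) * v i z)"
      by (simp add: fun_Compl_def sum_negf)
    then show ?thesis using int_spanI by metis
  qed
qed

text \<open>The coset of an integral combination only depends on its coefficients modulo \<open>K\<close>.\<close>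

lemma finite_cosets_int_span:
  assumes M: "is_lattice M" and K: "K > (0::nat)"
    and mult: "\<And>\<phi>. \<phi> \<in> int_span n v \<Longrightarrow> (\<lambda>x. of_nat K * \<phi> x) \<in> M"
  shows "finite (coset M ` int_span n v)"
proof -
  define comb where "comb c = (\<lambda>x. \<Sum>i=1..n. of_int (c i) * v i x)" for c
  have "coset M \<phi> \<in> (\<lambda>c. coset M (comb c)) ` ({1..n} \<rightarrow>\<^sub>E {0..<int K})" if \<phi>: "\<phi> \<in> int_span n v" for \<phi>
  proof -
    obtain c where c: "\<phi> = comb c"
      using \<phi> by (auto simp: int_span_def comb_def)
    \<comment> \<open>Reduced coefficients, restricted to \<open>{1..n}\<close> so that they range over a finite set.\<close>
    define c' where "c' = (\<lambda>i\<in>{1..n}. c i mod int K)"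
    have "\<phi> - comb c' = (\<lambda>x. of_nat K * comb (\<lambda>i. c i div int K) x)"
    proof
      fix x
      have "(of_int (c i) - of_int (c' i)) * v i x = of_nat K * (of_int (c i div int K) * v i x)"
        if "i \<in> {1..n}" for i
      proof -
        have "c i - c' i = int K * (c i div int K)"
          using that by (simp add: c'_def minus_mod_eq_mult_div)
        then have "(of_int (c i - c' i) :: complex) = of_int (int K * (c i div int K))"
          by (rule arg_cong)
        then have "(of_int (c i) - of_int (c' i) :: complex) = of_nat K * of_int (c i div int K)"
          by simp
        then show ?thesis by simp
      qed
      then have "(\<Sum>i=1..n. (of_int (c i) - of_int (c' i)) * v i x)
          = (\<Sum>i=1..n. of_nat K * (of_int (c i div int K) * v i x))"
        by (rule sum.cong[OF refl])
      then show "(\<phi> - comb c') x = of_nat K * comb (\<lambda>i. c i div int K) x"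
        by (simp add: c comb_def sum_distrib_left sum_subtractf left_diff_distrib)
    qed
    then have "\<phi> - comb c' \<in> M"
      using mult[OF int_spanI[of "\<lambda>i. c i div int K" v n]] by (simp add: comb_def)
    then have "coset M \<phi> = coset M (comb c')"
      by (simp add: coset_eq_iff M)
    moreover have "c' \<in> {1..n} \<rightarrow>\<^sub>E {0..<int K}"
      using K by (auto simp: c'_def)
    ultimately show ?thesis by blast
  qed
  then show ?thesis
    by (meson finite_PiE finite_atLeastAtMost finite_atLeastLessThan_int finite_imageI finite_subset image_subsetI)
qed

locale normalized_cartan_form = cartan_form scale bracket h B
  for scale :: "complex \<Rightarrow> 'g::ab_group_add \<Rightarrow> 'g" and bracket h B +
  fixes n :: nat and \<alpha> \<omega> :: "nat \<Rightarrow> 'g \<Rightarrow> complex"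
  assumes simple: "simple_roots scale bracket h n \<alpha>"
    and short: "short_roots_normalized scale bracket h B"
    and weights: "fundamental_weights scale h B n \<alpha> \<omega>"
begin

lemma root_length_nonzero: "\<beta> \<in> \<Phi> \<Longrightarrow> ip \<beta> \<beta> \<noteq> 0"
  using short by (force simp: short_roots_normalized_def)

lemma ip_rational: "\<beta> \<in> \<Phi> \<Longrightarrow> \<gamma> \<in> \<Phi> \<Longrightarrow> ip \<beta> \<gamma> \<in> \<rat>"
proof -
  assume "\<beta> \<in> \<Phi>" "\<gamma> \<in> \<Phi>"
  moreover obtain \<delta> where "\<delta> \<in> \<Phi>" "ip \<delta> \<delta> = 2"
    using short by (auto simp: short_roots_normalized_def)
  ultimately show ?thesis
    using ip_roots_rational[of \<delta> \<gamma> \<beta>] root_length_nonzero by simp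
qed

lemma simple_root: "i \<in> {1..n} \<Longrightarrow> \<alpha> i \<in> \<Phi>"
  using simple unfolding simple_roots_def by blast

lemma simple_root_dual: "i \<in> {1..n} \<Longrightarrow> \<alpha> i \<in> h_dual"
  using simple_root root_in_dual by blast

lemma simple_roots_generate:
  assumes "\<phi> \<in> h_dual"
  obtains c where "\<phi> = (\<lambda>x. \<Sum>i=1..n. c i * \<alpha> i x)"
proof -
  have "\<forall>\<phi>\<in>h_dual. \<exists>c :: nat \<Rightarrow> complex. \<phi> = (\<lambda>x. \<Sum>i=1..n. c i * \<alpha> i x)"
    using simple unfolding simple_roots_def by (elim conjE)
  then have "\<exists>c :: nat \<Rightarrow> complex. \<phi> = (\<lambda>x. \<Sum>i=1..n. c i * \<alpha> i x)"
    using assms by (rule bspec)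
  then show thesis
    by (elim exE) (rule that)
qed

lemma weight_dual: "i \<in> {1..n} \<Longrightarrow> \<omega> i \<in> h_dual"
  using weights unfolding fundamental_weights_def by blast

lemma ip_weight_rational:
  assumes i: "i \<in> {1..n}" and j: "j \<in> {1..n}"
  shows "ip (\<omega> i) (\<alpha> j) \<in> \<rat>"
proof -
  have "ip (\<omega> i) (\<alpha> j) = (if i = j then ip (\<alpha> i) (\<alpha> i) / 2 else 0)"
    using weights i j unfolding fundamental_weights_def by blast
  moreover have "(if i = j then ip (\<alpha> i) (\<alpha> i) / 2 else 0) \<in> \<rat>"
    using ip_rational[OF simple_root[OF i] simple_root[OF i]] by auto
  ultimately show ?thesis
    by (simp only:)
qed

text \<open>The complex coordinates of \<open>\<omega> i\<close> solve a linear system given by the numbers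
  \<open>(\<alpha> j, \<alpha> k)\<close> and \<open>(\<omega> i, \<alpha> k)\<close>, which are rational. Projecting them to the rationals gives another
  solution, and the solution is unique because the form is non-degenerate.\<close>

lemma weight_rational_combination:
  assumes i: "i \<in> {1..n}"
  obtains y where "\<And>j. y j \<in> \<rat>" "\<omega> i = (\<lambda>x. \<Sum>j=1..n. y j * \<alpha> j x)"
proof -
  obtain p :: "complex \<Rightarrow> complex" where p: "\<And>x y. p (x + y) = p x + p y"
    "\<And>q x. q \<in> \<rat> \<Longrightarrow> p (q * x) = q * p x" "\<And>x. p x \<in> \<rat>" "p 1 = 1"
    by (rule rational_projection) (rule that)
  have p0: "p 0 = 0"
    using p(2)[of 0 0] by simp
  have p_sum: "p (\<Sum>j\<in>J. u j) = (\<Sum>j\<in>J. p (u j))" for J :: "nat set" and u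
    by (induction J rule: infinite_finite_induct) (simp_all add: p0 p(1))
  obtain c where c: "\<omega> i = (\<lambda>x. \<Sum>j=1..n. c j * \<alpha> j x)"
    using weight_dual[OF i] by (rule simple_roots_generate)
  define y where "y j = p (c j)" for j
  let ?\<psi> = "\<lambda>x. \<Sum>j=1..n. y j * \<alpha> j x"
  have \<psi>: "?\<psi> \<in> h_dual"
    using simple_root_dual by (intro dual_sum) auto
  have "ip ?\<psi> (\<alpha> k) = ip (\<omega> i) (\<alpha> k)" if k: "k \<in> {1..n}" for k
  proof -
    have "ip (\<omega> i) (\<alpha> k) = p (ip (\<omega> i) (\<alpha> k))"
      using p(2)[OF ip_weight_rational[OF i k], of 1] p(4) by simp
    also have "\<dots> = p (\<Sum>j=1..n. c j * ip (\<alpha> j) (\<alpha> k))"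
      unfolding c using simple_root_dual k by (subst ip_sum_left) auto
    also have "\<dots> = (\<Sum>j=1..n. y j * ip (\<alpha> j) (\<alpha> k))"
      unfolding p_sum y_def
    proof (rule sum.cong[OF refl])
      fix j assume j: "j \<in> {1..n}"
      show "p (c j * ip (\<alpha> j) (\<alpha> k)) = p (c j) * ip (\<alpha> j) (\<alpha> k)"
        using p(2)[OF ip_rational[OF simple_root[OF j] simple_root[OF k]], of "c j"]
        by (simp only: mult.commute)
    qed
    also have "\<dots> = ip ?\<psi> (\<alpha> k)"
      using simple_root_dual k by (subst ip_sum_left) auto
    finally show ?thesis by simp
  qed
  then have zero: "ip (\<alpha> k) (\<omega> i + (\<lambda>x. - 1 * ?\<psi> x)) = 0" if k: "k \<in> {1..n}" for k
  proof -
    have "ip (\<omega> i + (\<lambda>x. - 1 * ?\<psi> x)) (\<alpha> k) = ip (\<omega> i) (\<alpha> k) + ip (\<lambda>x. - 1 * ?\<psi> x) (\<alpha> k)"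
      using ip_add_left[OF weight_dual[OF i] dual_scale[OF \<psi>] simple_root_dual[OF k]] .
    also have "ip (\<lambda>x. - 1 * ?\<psi> x) (\<alpha> k) = - ip ?\<psi> (\<alpha> k)"
      using ip_eq[OF dual_scale[OF \<psi>, of "-1"] simple_root_dual[OF k]]
        ip_eq[OF \<psi> simple_root_dual[OF k]] by simp
    finally show ?thesis
      using \<open>\<And>k. k \<in> {1..n} \<Longrightarrow> ip ?\<psi> (\<alpha> k) = ip (\<omega> i) (\<alpha> k)\<close>[OF k] 
      by (simp only: ip_sym[of "\<alpha> k"] add.right_inverse)
  qed
  have diff: "\<omega> i + (\<lambda>x. - 1 * ?\<psi> x) \<in> h_dual"
    using dual_add[OF weight_dual[OF i] dual_scale[OF \<psi>]] .
  have "\<omega> i + (\<lambda>x. - 1 * ?\<psi> x) = 0"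
  proof (rule ip_nondeg[OF diff])
    fix \<phi> assume "\<phi> \<in> h_dual"
    then obtain d where d: "\<phi> = (\<lambda>x. \<Sum>j=1..n. d j * \<alpha> j x)"
      by (rule simple_roots_generate)
    have "ip \<phi> (\<omega> i + (\<lambda>x. - 1 * ?\<psi> x)) = (\<Sum>j=1..n. d j * ip (\<alpha> j) (\<omega> i + (\<lambda>x. - 1 * ?\<psi> x)))"
      unfolding d by (rule ip_sum_left[OF _ diff]) (rule simple_root_dual)
    also have "\<dots> = 0"
      using zero by (intro sum.neutral) auto
    finally show "ip (\<omega> i + (\<lambda>x. - 1 * ?\<psi> x)) \<phi> = 0"
      by (simp only: ip_sym[of \<phi>])
  qed
  then have "\<omega> i = ?\<psi>"
    by (simp add: fun_eq_iff)
  then show thesis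
    using that[of y] p(3) by (simp add: y_def)
qed

lemma int_span_weights_dual: "\<phi> \<in> int_span n \<omega> \<Longrightarrow> \<phi> \<in> h_dual"
  by (auto simp: int_span_def intro!: dual_sum weight_dual)

lemma weight_multiple_in_root_lattice:
  obtains N :: nat where "N > 0" "\<And>\<phi>. \<phi> \<in> int_span n \<omega> \<Longrightarrow> (\<lambda>x. of_nat N * \<phi> x) \<in> int_span n \<alpha>"
proof -
  have "\<exists>y. \<forall>i\<in>{1..n}. (\<forall>j. y i j \<in> \<rat>) \<and> \<omega> i = (\<lambda>x. \<Sum>j=1..n. y i j * \<alpha> j x)"
  proof (intro bchoice ballI)
    fix i assume "i \<in> {1..n}"
    then obtain y where "\<And>j. y j \<in> \<rat>" "\<omega> i = (\<lambda>x. \<Sum>j=1..n. y j * \<alpha> j x)"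
      by (rule weight_rational_combination) (rule that)
    then show "\<exists>y. (\<forall>j. y j \<in> \<rat>) \<and> \<omega> i = (\<lambda>x. \<Sum>j=1..n. y j * \<alpha> j x)"
      by blast
  qed
  then obtain y where y: "\<And>i j. i \<in> {1..n} \<Longrightarrow> y i j \<in> \<rat>"
    "\<And>i. i \<in> {1..n} \<Longrightarrow> \<omega> i = (\<lambda>x. \<Sum>j=1..n. y i j * \<alpha> j x)"
    by blast
  obtain N :: nat where N: "N > 0"
    "\<And>ij. ij \<in> {1..n} \<times> {1..n} \<Longrightarrow> \<exists>k::int. of_nat N * (case ij of (i, j) \<Rightarrow> y i j) = of_int k"
    by (rule common_denominator[of "{1..n} \<times> {1..n}" "\<lambda>(i, j). y i j"]) (use y(1) in auto)
  have "\<exists>k. \<forall>i\<in>{1..n}. \<forall>j\<in>{1..n}. of_nat N * y i j = of_int (k i j)"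
    using N(2) by (intro bchoice ballI) force
  then obtain k where k: "\<And>i j. i \<in> {1..n} \<Longrightarrow> j \<in> {1..n} \<Longrightarrow> of_nat N * y i j = of_int (k i j)"
    by blast
  have "(\<lambda>x. of_nat N * \<phi> x) \<in> int_span n \<alpha>" if "\<phi> \<in> int_span n \<omega>" for \<phi>
  proof -
    from that obtain c where c: "\<phi> = (\<lambda>x. \<Sum>i=1..n. of_int (c i) * \<omega> i x)"
      by (auto simp: int_span_def)
    have "of_nat N * \<phi> x = (\<Sum>j=1..n. of_int (\<Sum>i=1..n. c i * k i j) * \<alpha> j x)" for x
    proof -
      have "of_nat N * \<phi> x = (\<Sum>i=1..n. \<Sum>j=1..n. of_int (c i) * (of_nat N * y i j) * \<alpha> j x)"
        unfolding c sum_distrib_left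
        by (rule sum.cong[OF refl]) (subst y(2), auto simp: sum_distrib_left mult_ac)
      also have "\<dots> = (\<Sum>i=1..n. \<Sum>j=1..n. of_int (c i * k i j) * \<alpha> j x)"
        by (intro sum.cong refl) (simp add: k)
      also have "\<dots> = (\<Sum>j=1..n. of_int (\<Sum>i=1..n. c i * k i j) * \<alpha> j x)"
        by (subst sum.swap) (simp add: sum_distrib_right)
      finally show ?thesis .
    qed
    then show ?thesis
      using int_spanI[of "\<lambda>j. \<Sum>i=1..n. c i * k i j" \<alpha> n] by simp
  qed
  then show thesis
    using N(1) that by blast
qed

lemma ip_scaled_integral:
  obtains M :: nat where "M > 0"
    "\<And>\<phi> \<psi>. \<phi> \<in> int_span n \<alpha> \<Longrightarrow> \<psi> \<in> int_span n \<omega> \<Longrightarrow> \<exists>k::int. of_nat M * ip \<phi> \<psi> = of_int k"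
proof -
  obtain M :: nat where M: "M > 0"
    "\<And>ij. ij \<in> {1..n} \<times> {1..n} \<Longrightarrow> \<exists>k::int. of_nat M * (case ij of (i, j) \<Rightarrow> ip (\<omega> i) (\<alpha> j)) = of_int k"
    by (rule common_denominator[of "{1..n} \<times> {1..n}" "\<lambda>(i, j). ip (\<omega> i) (\<alpha> j)"])
      (use ip_weight_rational in auto)
  have "\<exists>k. \<forall>i\<in>{1..n}. \<forall>j\<in>{1..n}. of_nat M * ip (\<omega> i) (\<alpha> j) = of_int (k i j)"
    using M(2) by (intro bchoice ballI) force
  then obtain k where k: "\<And>i j. i \<in> {1..n} \<Longrightarrow> j \<in> {1..n} \<Longrightarrow> of_nat M * ip (\<omega> i) (\<alpha> j) = of_int (k i j)"
    by blast
  have "\<exists>k::int. of_nat M * ip \<phi> \<psi> = of_int k" if \<phi>\<psi>: "\<phi> \<in> int_span n \<alpha>" "\<psi> \<in> int_span n \<omega>" for \<phi> \<psi>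
  proof -
    obtain c where c: "\<phi> = (\<lambda>x. \<Sum>j=1..n. of_int (c j) * \<alpha> j x)"
      using \<phi>\<psi>(1) by (auto simp: int_span_def)
    obtain d where d: "\<psi> = (\<lambda>x. \<Sum>i=1..n. of_int (d i) * \<omega> i x)"
      using \<phi>\<psi>(2) by (auto simp: int_span_def)
    have "ip \<phi> \<psi> = (\<Sum>j=1..n. of_int (c j) * ip (\<alpha> j) \<psi>)"
      unfolding c by (rule ip_sum_left) (auto intro: simple_root_dual int_span_weights_dual \<phi>\<psi>)
    also have "\<dots> = (\<Sum>j=1..n. of_int (c j) * (\<Sum>i=1..n. of_int (d i) * ip (\<omega> i) (\<alpha> j)))"
    proof (rule sum.cong[OF refl])
      fix j assume j: "j \<in> {1..n}"
      have "ip \<psi> (\<alpha> j) = (\<Sum>i=1..n. of_int (d i) * ip (\<omega> i) (\<alpha> j))"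
        unfolding d by (rule ip_sum_left) (auto intro: simple_root_dual weight_dual j)
      then show "of_int (c j) * ip (\<alpha> j) \<psi> = of_int (c j) * (\<Sum>i=1..n. of_int (d i) * ip (\<omega> i) (\<alpha> j))"
        by (simp only: ip_sym[of \<psi>])
    qed
    finally have "of_nat M * ip \<phi> \<psi> = (\<Sum>j=1..n. of_int (c j) * (\<Sum>i=1..n. of_int (d i) * (of_nat M * ip (\<omega> i) (\<alpha> j))))"
      by (simp add: sum_distrib_left mult_ac)
    also have "\<dots> = of_int (\<Sum>j=1..n. c j * (\<Sum>i=1..n. d i * k i j))"
      by (simp add: k)
    finally show ?thesis by blast
  qed
  then show thesis
    using M(1) that by blast
qed

text \<open>If multiplication by \<open>N\<close> maps weights into the root lattice and \<open>M\<close> clears the denominators of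
  the form, then multiplication by \<open>l * M * N\<close> maps weights into the centralizer.\<close>

lemma finite_cosets_Cent:
  assumes l: "l \<ge> 1" and L: "L \<subseteq> int_span n \<omega>" and C: "is_lattice (Cent ip l (int_span n \<alpha>) L)"
  shows "finite (coset (Cent ip l (int_span n \<alpha>) L) ` int_span n \<omega>)"
proof -
  obtain N :: nat where N: "N > 0" "\<And>\<phi>. \<phi> \<in> int_span n \<omega> \<Longrightarrow> (\<lambda>x. of_nat N * \<phi> x) \<in> int_span n \<alpha>"
    by (rule weight_multiple_in_root_lattice) (rule that)
  obtain M :: nat where M: "M > 0"
    "\<And>\<phi> \<psi>. \<phi> \<in> int_span n \<alpha> \<Longrightarrow> \<psi> \<in> int_span n \<omega> \<Longrightarrow> \<exists>k::int. of_nat M * ip \<phi> \<psi> = of_int k"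
    by (rule ip_scaled_integral) (rule that)
  show ?thesis
  proof (rule finite_cosets_int_span[OF C, of "l * M * N"])
    fix \<phi> assume \<phi>: "\<phi> \<in> int_span n \<omega>"
    define \<chi> where "\<chi> = (\<lambda>x. of_nat N * \<phi> x)"
    have \<chi>: "\<chi> \<in> int_span n \<alpha>"
      using N(2)[OF \<phi>] by (simp add: \<chi>_def)
    have eq: "(\<lambda>x. of_nat (l * M * N) * \<phi> x) = (\<lambda>x. of_nat (l * M) * \<chi> x)"
      by (simp add: \<chi>_def mult_ac)
    have \<chi>d: "\<chi> \<in> h_dual"
      using dual_scale int_span_weights_dual \<phi> by (simp add: \<chi>_def)
    have "(\<lambda>x. of_nat (l * M) * \<chi> x) \<in> int_span n \<alpha>"
    proof -
      obtain c where "\<chi> = (\<lambda>x. \<Sum>i=1..n. of_int (c i) * \<alpha> i x)"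
        using \<chi> by (auto simp: int_span_def)
      then have "(\<lambda>x. of_nat (l * M) * \<chi> x) = (\<lambda>x. \<Sum>i=1..n. of_int (int (l * M) * c i) * \<alpha> i x)"
        by (simp add: sum_distrib_left mult_ac)
      then show ?thesis using int_spanI by metis
    qed
    moreover have "\<exists>k::int. ip (\<lambda>x. of_nat (l * M) * \<chi> x) \<mu> = of_nat l * of_int k" if \<mu>: "\<mu> \<in> L" for \<mu>
    proof -
      have \<mu>': "\<mu> \<in> int_span n \<omega>" "\<mu> \<in> h_dual"
        using \<mu> L int_span_weights_dual by auto
      obtain k :: int where "of_nat M * ip \<chi> \<mu> = of_int k"
        using M(2)[OF \<chi> \<mu>'(1)] by blast
      moreover have "ip (\<lambda>x. of_nat (l * M) * \<chi> x) \<mu> = of_nat l * (of_nat M * ip \<chi> \<mu>)"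
        using ip_eq[OF dual_scale[OF \<chi>d] \<mu>'(2)] ip_eq[OF \<chi>d \<mu>'(2)] by simp
      ultimately show ?thesis by auto
    qed
    ultimately show "(\<lambda>x. of_nat (l * M * N) * \<phi> x) \<in> Cent ip l (int_span n \<alpha>) L"
      unfolding eq Cent_def by blast
  qed (use l M N in auto)
qed

end

section \<open>Equivalence of the three conditions\<close>

theorem corollary3p13:
  fixes scale :: "complex \<Rightarrow> 'g::ab_group_add \<Rightarrow> 'g"
    and bracket :: "'g \<Rightarrow> 'g \<Rightarrow> 'g"
    and h :: "'g set"
    and n :: nat
    and \<alpha> \<omega> :: "nat \<Rightarrow> 'g \<Rightarrow> complex"
    and B :: "'g \<Rightarrow> 'g \<Rightarrow> complex"
    and l d :: nat
    and \<Lambda>\<^sub>R \<Lambda>\<^sub>W \<Lambda> \<Lambda>\<^sub>1 \<Lambda>\<^sub>2 \<Lambda>' :: "('g \<Rightarrow> complex) set"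
    and form :: "('g \<Rightarrow> complex) \<Rightarrow> ('g \<Rightarrow> complex) \<Rightarrow> complex"
    and g :: "('g \<Rightarrow> complex) set \<Rightarrow> ('g \<Rightarrow> complex) set \<Rightarrow> complex"
    and A :: "('g \<Rightarrow> complex) \<Rightarrow> ('g \<Rightarrow> complex)"
  assumes "simple_lie_algebra scale bracket"
    and "cartan_subalgebra scale bracket h"
    and "simple_roots scale bracket h n \<alpha>"
    and "invariant_form scale bracket B"
    and "short_roots_normalized scale bracket h B"
    and "fundamental_weights scale h B n \<alpha> \<omega>"
    and "form = dual_form h B"
    and "\<Lambda>\<^sub>R = int_span n \<alpha>" and "\<Lambda>\<^sub>W = int_span n \<omega>"
    and "l \<ge> 1"
    and "subgroup \<Lambda> (additive_group \<Lambda>\<^sub>W)" and "\<Lambda>\<^sub>R \<subseteq> \<Lambda>"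
    and "subgroup \<Lambda>\<^sub>1 (additive_group \<Lambda>)" and "\<Lambda>\<^sub>R \<subseteq> \<Lambda>\<^sub>1"
    and "subgroup \<Lambda>\<^sub>2 (additive_group \<Lambda>)" and "\<Lambda>\<^sub>R \<subseteq> \<Lambda>\<^sub>2"
    and "order (additive_group \<Lambda>\<^sub>1 Mod \<Lambda>\<^sub>R) = d"
    and "order (additive_group \<Lambda>\<^sub>2 Mod \<Lambda>\<^sub>R) = d"
    and "Cent form l \<Lambda>\<^sub>R \<Lambda>\<^sub>1 = \<Lambda>'"
    and "Cent form l \<Lambda>\<^sub>R \<Lambda>\<^sub>2 = \<Lambda>'"
    and "pairing (additive_group \<Lambda>\<^sub>1 Mod \<Lambda>\<^sub>R) (additive_group \<Lambda>\<^sub>2 Mod \<Lambda>\<^sub>R) g"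
    and "centralizer_transfer_map form l \<Lambda>\<^sub>R \<Lambda>\<^sub>2 A"
  shows "(quasitriangularity_conditions form l \<Lambda>\<^sub>R \<Lambda>\<^sub>1 \<Lambda>\<^sub>2 \<Lambda>' (f_map form l \<Lambda>\<^sub>R \<Lambda>\<^sub>1 \<Lambda>\<^sub>2 \<Lambda>' d g)
           \<longleftrightarrow> nondegenerate_pairing (additive_group \<Lambda>\<^sub>1 Mod \<Lambda>') (additive_group \<Lambda>\<^sub>2 Mod \<Lambda>')
                 (f_hat form l \<Lambda>\<^sub>R g))
       \<and> (nondegenerate_pairing (additive_group \<Lambda>\<^sub>1 Mod \<Lambda>') (additive_group \<Lambda>\<^sub>2 Mod \<Lambda>')
            (f_hat form l \<Lambda>\<^sub>R g)
           \<longleftrightarrow> nondegenerate_pairing (additive_group \<Lambda>\<^sub>1 Mod \<Lambda>\<^sub>R) (additive_group \<Lambda>\<^sub>2 Mod \<Lambda>\<^sub>R)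
                 (a_form form l \<Lambda>\<^sub>R g A))"
proof -
  interpret normalized_cartan_form scale bracket h B n \<alpha> \<omega>
    using assms(1-6)
    by (simp add: normalized_cartan_form_def normalized_cartan_form_axioms_def cartan_form_def cartan_form_axioms_def)
  note form = \<open>form = dual_form h B\<close> and span = \<open>\<Lambda>\<^sub>R = int_span n \<alpha>\<close> \<open>\<Lambda>\<^sub>W = int_span n \<omega>\<close>
  have W: "is_lattice \<Lambda>\<^sub>W" and R: "is_lattice \<Lambda>\<^sub>R"
    by (simp_all add: span lattice_int_span)
  have \<Lambda>: "is_lattice \<Lambda>" "\<Lambda> \<subseteq> \<Lambda>\<^sub>W"
    using assms(11) by (simp_all add: sublattice_iff[OF W])
  have \<Lambda>1: "is_lattice \<Lambda>\<^sub>1" "\<Lambda>\<^sub>1 \<subseteq> \<Lambda>\<^sub>W" and \<Lambda>2: "is_lattice \<Lambda>\<^sub>2" "\<Lambda>\<^sub>2 \<subseteq> \<Lambda>\<^sub>W"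
    using assms(13,15) \<Lambda> by (auto simp: sublattice_iff[OF \<Lambda>(1)])
  have dual: "\<phi> \<in> dual_space scale h" if "\<phi> \<in> \<Lambda>\<^sub>W" for \<phi>
    using that int_span_weights_dual by (simp add: span)
  have add: "form (x + y) z = form x z + form y z" if "x \<in> \<Lambda>\<^sub>W" "y \<in> \<Lambda>\<^sub>W" "z \<in> \<Lambda>\<^sub>W" for x y z
    using that ip_add_left dual by (simp add: form)
  have "\<Lambda>\<^sub>R \<subseteq> \<Lambda>\<^sub>W"
    using assms(12) \<Lambda>(2) by blast
  have L': "is_lattice \<Lambda>'"
    unfolding assms(19)[symmetric]
    by (rule lattice_Cent[OF W R \<open>\<Lambda>\<^sub>R \<subseteq> \<Lambda>\<^sub>W\<close> \<Lambda>1(2)]) (rule add)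
  then have "finite (coset \<Lambda>' ` \<Lambda>\<^sub>W)"
    using finite_cosets_Cent[OF assms(10), of \<Lambda>\<^sub>1] \<Lambda>1(2) assms(19) by (simp add: span form)
  then have fin: "finite (carrier (additive_group \<Lambda>\<^sub>1 Mod \<Lambda>'))" "finite (carrier (additive_group \<Lambda>\<^sub>2 Mod \<Lambda>'))"
    unfolding carrier_quotient using \<Lambda>1(2) \<Lambda>2(2) by (meson finite_subset image_mono)+
  have form_sym: "form x y = form y x" for x y
    unfolding form by (rule ip_sym)
  interpret transfer_setup form l d \<Lambda>\<^sub>W \<Lambda>\<^sub>R \<Lambda>\<^sub>1 \<Lambda>\<^sub>2 \<Lambda>' g A
    by (rule transfer_setup.intro) (fact assms W R \<Lambda>1 \<Lambda>2 fin add | rule form_sym)+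
  show ?thesis
    using quasitriangular_iff_f_hat_nondegenerate f_hat_nondegenerate_iff_a_form_nondegenerate by blast
qed

end
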